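(* Let $X$ be a compact metric space, let $f\colon X\to X$ be continuous, let $\Lambda$ be a closed subset of $X$, and suppose that one of the following holds: (1) $X=[0,1]$ and $f$ is a uniformly piecewise linear interval map on $[0,1]$ that takes values $0$ or $1$ at local extrema; (2) $X=[0,1]$, $f$ is a piecewise linear interval map with gradient modulus greater than $1$ and finitely many pieces, and $\Lambda$ does not contain the image of any critical point of $f$; (3) $f$ is a shift of finite type (and $X$ is the corresponding shift space). Then for any nonempty closed subset $Y\subseteq\Lambda$ the following are equivalent: (i) $Y$ has weak incompressibility; (ii) $Y$ is internally chain transitive; (iii) $Y=\omega(x_Y,f)$ for some $x_Y\in X$.
   Context: $(X,d)$ is a compact metric space and $f\colon X\to X$ is continuous. The $\omega$-limit set of $x\in X$ is $\omega(x,f)=\bigcap_{k=0}^\infty\overline{\{f^n(x):n\ge k\}}$. A finite sequence $x_0,\dots,x_m$ in $X$ is an $\varepsilon$-pseudo-orbit if $d(f(x_n),x_{n+1})<\varepsilon$ for $0\le n<m$. A set $Y\subseteq X$ is internally chain transitive if for all $x,y\in Y$ and every $\varepsilon>0$ there is an $\varepsilon$-pseudo-orbit $x_0=x,x_1,\dots,x_m=y$ with $m\ge1$ and all $x_i\in Y$. A set $Y\subseteq X$ is weakly incompressible (has weak incompressibility) if $M\cap\overline{f(Y\setminus M)}\neq\emptyset$ whenever $M$ is a nonempty, closed, proper subset of $Y$. A continuous interval map $f\colon[0,1]\to[0,1]$ is piecewise linear if there are points $0=c_0<c_1<\dots<c_m=1$ such that $f$ is linear (affine) on $[c_{i-1},c_i]$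 for $0<i\le m$. A piecewise linear map is uniformly piecewise linear if the modulus of its gradient is everywhere greater than $1$ and is the same on each of the $m$ subintervals. A critical point of a piecewise linear map is a turning point, i.e. a point of $(0,1)$ at which $f$ has a local extremum. A shift of finite type is the restriction of the shift map $\sigma$, $(\sigma x)_i=x_{i+1}$, to the set $X$ of all sequences in $\mathcal{A}^{\mathbb{N}}$ (one-sided) or $\mathcal{A}^{\mathbb{Z}}$ (two-sided), $\mathcal{A}$ a finite alphabet, that contain no word from some fixed finite set of forbidden words; $X$ carries (a metric inducing) the product topology.
   Formalization: (i)⇔(ii) is asserted unless Y={p} with f(p)≠p: such Y is vacuously weakly incompressible but not internally chain transitive (e.g. tent map, Y={1/4}). (ii)⇔(iii) holds for all Y. In (1), local extrema of f on [0,1] include the endpoints 0 and 1. *)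

theory Defs
  imports "HOL-Analysis.Analysis"
begin

section \<open>Limit sets, chain transitivity, incompressibility\<close>

definition omega_limit :: "'a metric \<Rightarrow> ('a \<Rightarrow> 'a) \<Rightarrow> 'a \<Rightarrow> 'a set" where
  "omega_limit X f x = (\<Inter>k. mtopology_of X closure_of {(f ^^ n) x | n. n \<ge> k})"

definition pseudo_orbit :: "'a metric \<Rightarrow> ('a \<Rightarrow> 'a) \<Rightarrow> real \<Rightarrow> nat \<Rightarrow> (nat \<Rightarrow> 'a) \<Rightarrow> bool" where
  "pseudo_orbit X f \<epsilon> m x \<longleftrightarrow>
     (\<forall>n\<le>m. x n \<in> mspace X) \<and> (\<forall>n<m. mdist X (f (x n)) (x (Suc n)) < \<epsilon>)"

definition internally_chain_transitive :: "'a metric \<Rightarrow> ('a \<Rightarrow> 'a) \<Rightarrow> 'a set \<Rightarrow> bool" where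
  "internally_chain_transitive X f Y \<longleftrightarrow>
     (\<forall>x\<in>Y. \<forall>y\<in>Y. \<forall>\<epsilon>>0. \<exists>m\<ge>1. \<exists>z.
        pseudo_orbit X f \<epsilon> m z \<and> z 0 = x \<and> z m = y \<and> (\<forall>n\<le>m. z n \<in> Y))"

definition weakly_incompressible :: "'a metric \<Rightarrow> ('a \<Rightarrow> 'a) \<Rightarrow> 'a set \<Rightarrow> bool" where
  "weakly_incompressible X f Y \<longleftrightarrow>
     (\<forall>M. M \<noteq> {} \<and> closedin (mtopology_of X) M \<and> M \<subset> Y \<longrightarrow>
        M \<inter> (mtopology_of X closure_of (f ` (Y - M))) \<noteq> {})"


section \<open>Piecewise linear interval maps\<close>

text \<open>Interval maps are total functions on the reals of which only the restriction to
  \<open>{0..1}\<close> matters.\<close>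

abbreviation unit_interval :: "real metric" where
  "unit_interval \<equiv> submetric euclidean_metric {0..1}"

definition interval_map :: "(real \<Rightarrow> real) \<Rightarrow> bool" where
  "interval_map f \<longleftrightarrow> continuous_on {0..1} f \<and> f ` {0..1} \<subseteq> {0..1}"

text \<open>The breakpoints are \<open>c 0 < \<dots> < c m\<close>, and \<open>g i\<close> is the gradient on the
  piece \<open>{c i..c (Suc i)}\<close>. Pieces are nondegenerate, so \<open>g i\<close> is determined for \<open>i < m\<close>.\<close>

definition linear_pieces ::
    "(real \<Rightarrow> real) \<Rightarrow> nat \<Rightarrow> (nat \<Rightarrow> real) \<Rightarrow> (nat \<Rightarrow> real) \<Rightarrow> bool" where
  "linear_pieces f m c g \<longleftrightarrow>
     c 0 = 0 \<and> c m = 1 \<and> (\<forall>i<m. c i < c (Suc i)) \<and>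
     (\<forall>i<m. \<exists>b. \<forall>x\<in>{c i..c (Suc i)}. f x = g i * x + b)"

definition expanding_piecewise_linear :: "(real \<Rightarrow> real) \<Rightarrow> bool" where
  "expanding_piecewise_linear f \<longleftrightarrow>
     interval_map f \<and> (\<exists>m c g. linear_pieces f m c g \<and> (\<forall>i<m. \<bar>g i\<bar> > 1))"

definition uniformly_piecewise_linear :: "(real \<Rightarrow> real) \<Rightarrow> bool" where
  "uniformly_piecewise_linear f \<longleftrightarrow>
     interval_map f \<and> (\<exists>m c g s. linear_pieces f m c g \<and> s > 1 \<and> (\<forall>i<m. \<bar>g i\<bar> = s))"

text \<open>Extrema are relative to \<open>{0..1}\<close>, so the endpoints 0 and 1 can be local extrema; critical
  points, by contrast, are interior.\<close>

definition local_extremum :: "(real \<Rightarrow> real) \<Rightarrow> real \<Rightarrow> bool" where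
  "local_extremum f x \<longleftrightarrow> x \<in> {0..1} \<and>
     ((\<forall>\<^sub>F y in at x within {0..1}. f y \<le> f x) \<or> (\<forall>\<^sub>F y in at x within {0..1}. f y \<ge> f x))"

definition critical_point :: "(real \<Rightarrow> real) \<Rightarrow> real \<Rightarrow> bool" where
  "critical_point f x \<longleftrightarrow> x \<in> {0<..<1} \<and> local_extremum f x"


section \<open>Shifts of finite type\<close>

text \<open>The index type is \<open>nat\<close> for one-sided and \<open>int\<close> for two-sided shifts.\<close>

definition shift :: "('i::semiring_1 \<Rightarrow> 'a) \<Rightarrow> 'i \<Rightarrow> 'a" where
  "shift x = (\<lambda>i. x (i + 1))"

definition contains_word :: "('i::semiring_1 \<Rightarrow> 'a) \<Rightarrow> 'a list \<Rightarrow> bool" where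
  "contains_word x w \<longleftrightarrow> (\<exists>i. \<forall>j<length w. x (i + of_nat j) = w ! j)"

definition shift_space :: "'a set \<Rightarrow> 'a list set \<Rightarrow> ('i::semiring_1 \<Rightarrow> 'a) set" where
  "shift_space A F = {x. range x \<subseteq> A \<and> (\<forall>w\<in>F. \<not> contains_word x w)}"

definition shift_topology :: "'a set \<Rightarrow> 'a list set \<Rightarrow> ('i::semiring_1 \<Rightarrow> 'a) topology" where
  "shift_topology A F =
     subtopology (product_topology (\<lambda>_. discrete_topology A) UNIV) (shift_space A F)"

text \<open>\<open>X\<close> is the shift space with alphabet \<open>A\<close> and finite set \<open>F\<close> of forbidden words, under an
  arbitrary metric inducing the product topology; in particular \<open>mspace X = shift_space A F\<close>.\<close>

definition finite_type_shift_space :: "('i::semiring_1 \<Rightarrow> 'a) metric \<Rightarrow> 'a set \<Rightarrow> 'a list set \<Rightarrow> bool"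
  where "finite_type_shift_space X A F \<longleftrightarrow>
     finite A \<and> finite F \<and> mtopology_of X = shift_topology A F"

end

theory Submission
  imports Defs
begin

text \<open>
  The first equivalence and the chain transitivity of limit sets hold for every continuous map
  \<open>f\<close> of a compact metric space. If \<open>Y\<close> is weakly incompressible, the set of points of \<open>Y\<close>
  that are out of reach of \<open>\<epsilon>\<close>-chains from a given point cannot be nonempty
  (\<open>weakly_incompressible_imp_chain_transitive\<close>). Conversely, a chain that enters a closed set
  \<open>M\<close> has a first jump into it, and short jumps show that \<open>M\<close> meets the closure of
  \<open>f ` (Y - M)\<close> (\<open>chain_transitive_imp_weakly_incompressible\<close>). Chains inside a limit set come
  from perturbing late orbit segments (\<open>omega_limit_chain_transitive\<close>). Singletons are weakly
  incompressible for the trivial reason that they have no nonempty proper subset, but chain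
  transitive only if they are fixed, whence the condition on them.

  What depends on the map is the construction of a point \<open>x\<close> whose limit set is a given chain
  transitive set \<open>Y\<close>. Chain transitivity gives a sequence in \<open>Y\<close> with dense tails which is almost
  an orbit, the error \<open>d (f (z n)) (z (n + 1))\<close> tending to zero
  (\<open>chain_transitive_imp_asymptotic_orbit\<close>). If some true orbit is asymptotic to this sequence, its
  limit set is \<open>Y\<close> (\<open>shadowing_imp_omega_limit\<close>). It remains to prove this form of shadowing.

  For interval maps the shadowing orbit is found by pulling back. Suppose that every value \<open>y\<close> near
  \<open>f x\<close>, for \<open>x \<in> Y\<close>, has a preimage \<open>x'\<close> with \<open>\<kappa> * \<bar>x' - x\<bar> \<le> \<bar>y - f x\<bar>\<close>, where
  \<open>\<kappa> > 1\<close>. Then errors contract in backward time, and the finite backward constructions converge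
  (\<open>expanding_lifts_imp_asymptotic_shadowing\<close>). With slopes greater than one, such lifts exist
  except near a fold or an end of the graph at a height strictly between \<open>0\<close> and \<open>1\<close>; at height
  \<open>0\<close> or \<open>1\<close> nothing has to be lifted beyond the fold. So it is enough that local extrema in \<open>Y\<close>,
  ends of the interval included, have value \<open>0\<close> or \<open>1\<close> (\<open>uniformly_liftable\<close>). One class of maps
  has this property by assumption. For the other, \<open>Y\<close> contains no critical point, and an end of the
  interval that belongs to \<open>Y\<close> has all its preimages in \<open>Y\<close> among the ends; since \<open>f ` Y = Y\<close>, this
  makes the ends in \<open>Y\<close> map to ends (\<open>extreme_value_of_invariant_set\<close>).

  For a shift of finite type, small errors mean that \<open>\<sigma> (z n)\<close> and \<open>z (n + 1)\<close> agree on a long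
  window, and the zeroth symbols of the \<open>z n\<close> can be glued to one sequence. Short words of this
  sequence are words of the \<open>z n\<close>, so none of them is forbidden (\<open>glue_in_shift_space\<close>), and its
  orbit is asymptotic to the pseudo-orbit (\<open>shift_asymptotic_shadowing\<close>).
\<close>

section \<open>Dynamics on compact metric spaces\<close>

text \<open>The metric is abstract because the phase spaces are of two kinds: an interval with the distance
  of \<open>real\<close>, and a space of sequences with an arbitrary compatible metric.\<close>
locale compact_dynamics =
  fixes X :: "'a metric" and f :: "'a \<Rightarrow> 'a"
  assumes compact: "compact_space (mtopology_of X)"
    and continuous: "continuous_map (mtopology_of X) (mtopology_of X) f"
begin

sublocale ms: Metric_space "mspace X" "mdist X"
  by simp

lemma mtopology_eq: "mtopology_of X = ms.mtopology"
  by (simp add: mtopology_of_def)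

lemma f_in [simp]: "x \<in> mspace X \<Longrightarrow> f x \<in> mspace X"
  using continuous by (auto simp: continuous_map_def)

lemma funpow_in [simp]: "x \<in> mspace X \<Longrightarrow> (f ^^ n) x \<in> mspace X"
  by (induction n) auto

lemma uniformly_continuous:
  assumes "\<epsilon> > 0"
  obtains \<delta> where "\<delta> > 0"
    "\<And>x y. x \<in> mspace X \<Longrightarrow> y \<in> mspace X \<Longrightarrow> mdist X x y < \<delta> \<Longrightarrow> mdist X (f x) (f y) < \<epsilon>"
proof -
  have "uniformly_continuous_map X X f"
    using compact continuous continuous_imp_uniformly_continuous_map by blast
  then show thesis
    using that assms unfolding uniformly_continuous_map_def by metis
qed

lemma convergent_subsequence:
  assumes "\<And>n. s n \<in> mspace X"
  obtains l r where "l \<in> mspace X" "strict_mono (r :: nat \<Rightarrow> nat)"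
    "(\<lambda>n. mdist X (s (r n)) l) \<longlonglongrightarrow> 0"
proof -
  obtain l r where "l \<in> mspace X" "strict_mono r" "limitin ms.mtopology (s \<circ> r) l sequentially"
    using compact assms unfolding mtopology_eq ms.compact_space_sequentially by blast
  then show thesis
    using that by (auto simp: ms.limitin_metric_dist_null)
qed

lemma mem_closedI:
  assumes "closedin (mtopology_of X) Y" "x \<in> mspace X" "\<And>\<epsilon>. \<epsilon> > 0 \<Longrightarrow> \<exists>y\<in>Y. mdist X x y < \<epsilon>"
  shows "x \<in> Y"
  using assms unfolding mtopology_eq ms.closedin_metric disjnt_iff ms.in_mball
  by (metis Diff_iff subsetD)

lemma mem_closure_iff:
  assumes "S \<subseteq> mspace X"
  shows "y \<in> mtopology_of X closure_of S \<longleftrightarrow>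
    y \<in> mspace X \<and> (\<forall>\<epsilon>>0. \<exists>s\<in>S. mdist X y s < \<epsilon>)"
  using assms unfolding mtopology_eq ms.metric_closure_of by (auto; blast)

lemma mem_omega_limit_iff:
  assumes "x \<in> mspace X"
  shows "y \<in> omega_limit X f x \<longleftrightarrow>
    y \<in> mspace X \<and> (\<forall>\<epsilon>>0. \<forall>k. \<exists>n\<ge>k. mdist X y ((f ^^ n) x) < \<epsilon>)"
proof -
  have "{(f ^^ n) x |n. k \<le> n} \<subseteq> mspace X" for k
    using assms by auto
  from mem_closure_iff[OF this] show ?thesis
    unfolding omega_limit_def by (auto; metis)
qed

lemma chain_transitiveE:
  assumes "internally_chain_transitive X f Y" "x \<in> Y" "y \<in> Y" "\<epsilon> > 0"
  obtains m z where "m \<ge> 1" "pseudo_orbit X f \<epsilon> m z" "z 0 = x" "z m = y" "\<forall>n\<le>m. z n \<in> Y"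
  using assms unfolding internally_chain_transitive_def by metis

text \<open>These are the first and the last step of an \<open>\<epsilon>\<close>-chain from \<open>x\<close> back to \<open>x\<close>.\<close>
lemma chain_transitive_neighbours:
  assumes "internally_chain_transitive X f Y" "Y \<subseteq> mspace X" "x \<in> Y" "\<epsilon> > 0"
  shows "\<exists>y\<in>Y. mdist X (f x) y < \<epsilon>" "\<exists>y\<in>Y. mdist X (f y) x < \<epsilon>"
proof -
  obtain m z where z: "m \<ge> 1" "pseudo_orbit X f \<epsilon> m z" "z 0 = x" "z m = x" "\<forall>n\<le>m. z n \<in> Y"
    using chain_transitiveE[OF assms(1,3,3,4)] by metis
  have "0 < m" "m - 1 < m"
    using z(1) by auto
  then have "mdist X (f (z 0)) (z (Suc 0)) < \<epsilon>" "mdist X (f (z (m - 1))) (z (Suc (m - 1))) < \<epsilon>"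
    using z(2) unfolding pseudo_orbit_def by blast+
  moreover have "z (Suc 0) \<in> Y" "z (m - 1) \<in> Y" "Suc (m - 1) = m"
    using z by auto
  ultimately show "\<exists>y\<in>Y. mdist X (f x) y < \<epsilon>" "\<exists>y\<in>Y. mdist X (f y) x < \<epsilon>"
    using z by metis+
qed

text \<open>Both \<open>Y\<close> and, by compactness, \<open>f ` Y\<close> are closed, so that the approximate statements for
  every \<open>\<epsilon>\<close> become exact.\<close>
lemma chain_transitive_imp_image_eq:
  assumes Y: "closedin (mtopology_of X) Y" and ict: "internally_chain_transitive X f Y"
  shows "f ` Y = Y"
proof
  have sub: "Y \<subseteq> mspace X"
    using closedin_subset[OF Y] by simp
  note ict = chain_transitive_neighbours[OF ict sub]
  show "f ` Y \<subseteq> Y"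
  proof
    fix w assume "w \<in> f ` Y"
    then obtain y where y: "y \<in> Y" "w = f y"
      by blast
    then show "w \<in> Y"
      using mem_closedI[OF Y, of w] ict(1)[OF y(1)] sub by auto
  qed
  have "compactin (mtopology_of X) (f ` Y)"
    using Y compact closedin_compact_space continuous image_compactin by blast
  then have "closedin (mtopology_of X) (f ` Y)"
    by (metis compactin_imp_closedin ms.Hausdorff_space_mtopology mtopology_eq)
  moreover have "\<exists>z\<in>f ` Y. mdist X y z < \<epsilon>" if "y \<in> Y" "\<epsilon> > 0" for y \<epsilon>
    using ict(2)[OF that] by (metis imageI mdist_commute)
  ultimately show "Y \<subseteq> f ` Y"
    using mem_closedI[of "f ` Y"] sub by (meson subsetD subsetI)
qed

section \<open>Weak incompressibility and chain transitivity\<close>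

text \<open>If \<open>f p\<close> lies outside \<open>Y\<close>, remove a ball around \<open>p\<close> from \<open>Y\<close> that is so small that its
  image stays away from \<open>Y\<close>. What is left over violates weak incompressibility, unless it is
  empty. The radius is chosen to keep a second point of \<open>Y\<close>, so only a singleton can escape; a
  singleton has no nonempty proper subsets and is weakly incompressible whether fixed or not,
  which is why singletons need the separate condition.\<close>
lemma weakly_incompressible_imp_image_subset:
  assumes Y: "closedin (mtopology_of X) Y" and wi: "weakly_incompressible X f Y"
    and single: "\<And>p. Y = {p} \<Longrightarrow> f p = p"
  shows "f ` Y \<subseteq> Y"
proof (rule ccontr)
  have sub: "Y \<subseteq> mspace X"
    using closedin_subset[OF Y] by simp
  assume "\<not> f ` Y \<subseteq> Y"
  then obtain p where p: "p \<in> Y" "f p \<notin> Y"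
    by blast
  then have "Y \<noteq> {p}"
    using single by auto
  then obtain q where q: "q \<in> Y" "q \<noteq> p"
    using p by blast
  obtain \<epsilon> where e: "\<epsilon> > 0" "\<And>y. y \<in> Y \<Longrightarrow> mdist X (f p) y \<ge> \<epsilon>"
    using mem_closedI[OF Y] p sub by (metis f_in leI subsetD)
  obtain \<delta> where d: "\<delta> > 0" "\<And>x y. x \<in> mspace X \<Longrightarrow> y \<in> mspace X \<Longrightarrow>
      mdist X x y < \<delta> \<Longrightarrow> mdist X (f x) (f y) < \<epsilon>/2"
    using uniformly_continuous[of "\<epsilon>/2"] e(1) by auto
  define \<rho> where "\<rho> = min \<delta> (mdist X p q)"
  have "mdist X p q > 0"
    using p q sub by (intro ms.mdist_pos_less) auto
  then have "\<rho> > 0"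
    using d(1) by (simp add: \<rho>_def)
  define M where "M = Y - ms.mball p \<rho>"
  have cl: "closedin (mtopology_of X) M"
    using Y unfolding M_def mtopology_eq by blast
  have "p \<in> Y - M"
    using p sub \<open>\<rho> > 0\<close> by (auto simp: M_def)
  moreover have "q \<in> M"
    using q by (simp add: M_def \<rho>_def)
  ultimately have "q \<in> M" "p \<in> Y - M" "M \<subset> Y"
    unfolding M_def by blast+
  then obtain y where y: "y \<in> M" "y \<in> mtopology_of X closure_of (f ` (Y - M))"
    using wi cl unfolding weakly_incompressible_def by blast
  have fY: "f ` (Y - M) \<subseteq> mspace X"
    using sub by auto
  obtain w where w: "w \<in> Y - M" "mdist X y (f w) < \<epsilon>/2"
    using y(2) e(1) unfolding mem_closure_iff[OF fY] by (metis half_gt_zero imageE)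
  have "mdist X (f p) (f w) < \<epsilon>/2"
    using w p sub by (intro d) (auto simp: M_def \<rho>_def)
  moreover have "mdist X (f p) y \<le> mdist X (f p) (f w) + mdist X y (f w)"
    using ms.triangle[of "f p" "f w" y] w(1) y(1) p sub
    by (simp add: M_def mdist_commute[of X "f w"] subset_iff)
  ultimately show False
    using e(2)[of y] y w(2) by (auto simp: M_def)
qed

text \<open>A chain that ends in \<open>M\<close> has to jump from the image of a point outside \<open>M\<close> into \<open>M\<close>. As the
  jumps get shorter, compactness turns this into a point of \<open>M\<close> in the closure of
  \<open>f ` (Y - M)\<close>.\<close>
lemma chain_transitive_imp_weakly_incompressible:
  assumes Y: "closedin (mtopology_of X) Y" and ict: "internally_chain_transitive X f Y"
  shows "weakly_incompressible X f Y"
  unfolding weakly_incompressible_def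
proof (intro allI impI, elim conjE)
  have sub: "Y \<subseteq> mspace X"
    using closedin_subset[OF Y] by simp
  fix M assume M: "M \<noteq> {}" "closedin (mtopology_of X) M" "M \<subset> Y"
  define C where "C = mtopology_of X closure_of (f ` (Y - M))"
  have fY: "f ` (Y - M) \<subseteq> mspace X"
    using sub by auto
  obtain x y where xy: "x \<in> Y - M" "y \<in> M"
    using M by blast
  \<comment> \<open>A chain from outside \<open>M\<close> into \<open>M\<close> has a first step into \<open>M\<close>, and this step
    exhibits points of \<open>f ` (Y - M)\<close> and \<open>M\<close> at distance less than \<open>\<epsilon>\<close>.\<close>
  have step: "\<exists>w\<in>Y - M. \<exists>v\<in>M. mdist X (f w) v < \<epsilon>" if e: "\<epsilon> > 0" for \<epsilon>
  proof -
    obtain m z where z: "m \<ge> 1" "pseudo_orbit X f \<epsilon> m z" "z 0 = x" "z m = y" "\<forall>n\<le>m. z n \<in> Y"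
      using chain_transitiveE[OF ict _ _ e, of x y] xy M by blast
    have "\<exists>k<m. z k \<notin> M \<and> z (Suc k) \<in> M"
    proof (rule ccontr)
      assume *: "\<not> ?thesis"
      have "k \<le> m \<Longrightarrow> z k \<notin> M" for k
        by (induction k) (use * xy z in \<open>auto simp: Suc_le_eq\<close>)
      then show False
        using xy z by blast
    qed
    then show ?thesis
      using z unfolding pseudo_orbit_def by (metis DiffI Suc_leI less_imp_le)
  qed
  obtain w v where wv: "\<And>n. w n \<in> Y - M \<and> v n \<in> M \<and> mdist X (f (w n)) (v n) < 1 / Suc n"
    using step[of "1 / real (Suc n)" for n] by (metis of_nat_0_less_iff zero_less_Suc zero_less_divide_1_iff)
  obtain l r where lr: "l \<in> mspace X" "strict_mono r" "(\<lambda>n. mdist X (v (r n)) l) \<longlonglongrightarrow> 0"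
    using convergent_subsequence[of v] wv M sub by blast
  have near: "\<exists>n. mdist X l (v n) < \<epsilon> \<and> mdist X (f (w n)) (v n) < \<epsilon>" if "\<epsilon> > 0" for \<epsilon>
  proof -
    have "(\<lambda>n. 1 / real (Suc n)) \<longlonglongrightarrow> 0"
      using LIMSEQ_inverse_real_of_nat by (simp add: inverse_eq_divide)
    then have "(\<lambda>n. 1 / real (Suc (r n))) \<longlonglongrightarrow> 0"
      using LIMSEQ_subseq_LIMSEQ[OF _ lr(2)] by (auto simp: o_def)
    then have "\<forall>\<^sub>F n in sequentially. 1 / real (Suc (r n)) < \<epsilon>"
      using that by (rule order_tendstoD)
    moreover have "\<forall>\<^sub>F n in sequentially. mdist X (v (r n)) l < \<epsilon>"
      using lr(3) that by (rule order_tendstoD)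
    ultimately have "\<forall>\<^sub>F n in sequentially. mdist X (v (r n)) l < \<epsilon> \<and> 1 / real (Suc (r n)) < \<epsilon>"
      by (simp add: eventually_conj_iff)
    then obtain n where "mdist X (v (r n)) l < \<epsilon>" "1 / real (Suc (r n)) < \<epsilon>"
      by (auto simp: eventually_sequentially)
    then show ?thesis
      using wv[of "r n"] by (metis mdist_commute order.strict_trans)
  qed
  have "l \<in> M"
    using mem_closedI[OF M(2) lr(1)] near wv by metis
  moreover have "l \<in> mtopology_of X closure_of (f ` (Y - M))"
    unfolding mem_closure_iff[OF fY]
  proof (intro conjI allI impI lr(1))
    fix \<epsilon> :: real assume "\<epsilon> > 0"
    then obtain n where n: "mdist X l (v n) < \<epsilon>/2" "mdist X (f (w n)) (v n) < \<epsilon>/2"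
      using near[of "\<epsilon>/2"] by auto
    have "mdist X l (f (w n)) \<le> mdist X l (v n) + mdist X (f (w n)) (v n)"
      using ms.triangle[of l "v n" "f (w n)"] lr(1) wv[of n] M(3) sub
      by (simp add: mdist_commute[of X "v n"] subset_iff psubset_eq)
    then show "\<exists>s\<in>f ` (Y - M). mdist X l s < \<epsilon>"
      using n wv[of n] by (intro bexI[of _ "f (w n)"]) auto
  qed
  ultimately show "M \<inter> mtopology_of X closure_of (f ` (Y - M)) \<noteq> {}"
    by blast
qed

text \<open>The points that no \<open>\<epsilon>\<close>-chain from \<open>x\<close> reaches form a closed set \<open>M\<close>. A point of \<open>M\<close> within
  \<open>\<epsilon>\<close> of the image of a reachable point would be reachable, so \<open>M\<close> misses the closure of
  \<open>f ` (Y - M)\<close>. As \<open>f x\<close> is reachable, \<open>M\<close> is a proper subset of \<open>Y\<close>, and weak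
  incompressibility leaves only \<open>M = {}\<close>.\<close>
lemma weakly_incompressible_imp_chain_transitive:
  assumes Y: "closedin (mtopology_of X) Y" and wi: "weakly_incompressible X f Y"
    and single: "\<And>p. Y = {p} \<Longrightarrow> f p = p"
  shows "internally_chain_transitive X f Y"
  unfolding internally_chain_transitive_def
proof (intro ballI allI impI)
  have sub: "Y \<subseteq> mspace X"
    using closedin_subset[OF Y] by simp
  have inv: "f ` Y \<subseteq> Y"
    using weakly_incompressible_imp_image_subset[OF assms] .
  fix x y and \<epsilon> :: real assume x: "x \<in> Y" and y: "y \<in> Y" and e: "\<epsilon> > 0"
  define reach where "reach w \<longleftrightarrow> (\<exists>m\<ge>1. \<exists>z. pseudo_orbit X f \<epsilon> m z \<and> z 0 = x \<and> z m = w \<and> (\<forall>n\<le>m. z n \<in> Y))"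
    for w
  define M where "M = {w\<in>Y. \<not> reach w}"
  have fx: "reach (f x)"
    unfolding reach_def pseudo_orbit_def
    by (rule exI[of _ 1], intro conjI, simp, rule exI[of _ "\<lambda>n. if n = 0 then x else f x"])
      (use x inv sub e in \<open>auto simp: image_subset_iff\<close>)
  have extend: "reach v" if w: "reach w" "v \<in> Y" "mdist X (f w) v < \<epsilon>" for w v
  proof -
    obtain m z where z: "m \<ge> 1" "pseudo_orbit X f \<epsilon> m z" "z 0 = x" "z m = w" "\<forall>n\<le>m. z n \<in> Y"
      using w(1) unfolding reach_def by blast
    show ?thesis
      unfolding reach_def
      by (rule exI[of _ "Suc m"], intro conjI, simp, rule exI[of _ "z(Suc m := v)"])
        (use z w sub in \<open>auto simp: pseudo_orbit_def less_Suc_eq le_Suc_eq\<close>)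
  qed
  \<comment> \<open>The last step of a chain may be moved slightly, so the reachable set is open in \<open>Y\<close>.\<close>
  have cl: "closedin (mtopology_of X) M"
    unfolding mtopology_eq ms.closedin_metric
  proof (intro conjI allI impI)
    show "M \<subseteq> mspace X"
      using sub by (auto simp: M_def)
    fix w assume w: "w \<in> mspace X - M"
    show "\<exists>r>0. disjnt M (ms.mball w r)"
    proof (cases "w \<in> Y")
      case False
      then obtain r where "r > 0" "disjnt Y (ms.mball w r)"
        using Y w unfolding mtopology_eq ms.closedin_metric by blast
      then show ?thesis
        by (auto simp: disjnt_iff M_def)
    next
      case True
      then obtain m z where z: "m \<ge> 1" "pseudo_orbit X f \<epsilon> m z" "z 0 = x" "z m = w" "\<forall>n\<le>m. z n \<in> Y"
        using w unfolding M_def reach_def by auto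
      define u where "u = z (m - 1)"
      have u: "u \<in> Y" "mdist X (f u) w < \<epsilon>"
        using z unfolding pseudo_orbit_def u_def by (auto dest: spec[of _ "m - 1"])
      have "reach v" if "v \<in> Y" "mdist X w v < \<epsilon> - mdist X (f u) w" for v
        unfolding reach_def
      proof (intro exI[of _ m] exI[of _ "z(m := v)"] conjI z(1))
        have "mdist X (f u) v \<le> mdist X (f u) w + mdist X w v"
          using ms.triangle[of "f u" w v] u(1) that(1) sub w by (simp add: subset_iff)
        then have "mdist X (f u) v < \<epsilon>"
          using that by simp
        then have "mdist X (f (z n)) ((z(m := v)) (Suc n)) < \<epsilon>" if "n < m" for n
          using z(1,2) that unfolding pseudo_orbit_def u_def
          by (cases "Suc n = m") auto
        then show "pseudo_orbit X f \<epsilon> m (z(m := v))"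
          using z that(1) sub unfolding pseudo_orbit_def by auto
      qed (use z that in auto)
      then show ?thesis
        using u by (intro exI[of _ "\<epsilon> - mdist X (f u) w"]) (auto simp: disjnt_iff M_def)
    qed
  qed
  have fY: "f ` (Y - M) \<subseteq> mspace X"
    using sub by auto
  have "M \<inter> mtopology_of X closure_of (f ` (Y - M)) = {}"
  proof (rule ccontr)
    assume "\<not> ?thesis"
    then obtain v where v: "v \<in> M" "v \<in> mtopology_of X closure_of (f ` (Y - M))"
      by blast
    then obtain w where "w \<in> Y - M" "mdist X v (f w) < \<epsilon>"
      using e unfolding mem_closure_iff[OF fY] by blast
    then show False
      using extend[of w v] v by (auto simp: M_def mdist_commute)
  qed
  moreover have "M \<subset> Y"
    using fx x inv by (auto simp: M_def)
  ultimately have "M = {}"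
    using wi cl unfolding weakly_incompressible_def by blast
  then show "\<exists>m\<ge>1. \<exists>z. pseudo_orbit X f \<epsilon> m z \<and> z 0 = x \<and> z m = y \<and> (\<forall>n\<le>m. z n \<in> Y)"
    using y unfolding M_def reach_def by blast
qed

section \<open>Chain transitivity of limit sets\<close>

lemma omega_limit_attracts:
  assumes x: "x \<in> mspace X" and "\<epsilon> > 0"
  shows "\<exists>N. \<forall>n\<ge>N. \<exists>y\<in>omega_limit X f x. mdist X ((f ^^ n) x) y < \<epsilon>"
proof (rule ccontr)
  assume "\<not> ?thesis"
  then obtain s where s: "\<And>N. s N \<ge> N" "\<And>N y. y \<in> omega_limit X f x \<Longrightarrow> mdist X ((f ^^ s N) x) y \<ge> \<epsilon>"
    by (metis leI)
  obtain l r where lr: "l \<in> mspace X" "strict_mono r" "(\<lambda>n. mdist X ((f ^^ s (r n)) x) l) \<longlonglongrightarrow> 0"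
    using convergent_subsequence[of "\<lambda>n. (f ^^ s n) x"] x by auto
  have ev: "\<exists>N. \<forall>n\<ge>N. mdist X ((f ^^ s (r n)) x) l < \<eta>" if "\<eta> > 0" for \<eta>
    using order_tendstoD(2)[OF lr(3) that] by (simp add: eventually_sequentially)
  have "l \<in> omega_limit X f x"
    unfolding mem_omega_limit_iff[OF x]
  proof (intro conjI allI impI lr(1))
    fix \<eta> :: real and k assume "\<eta> > 0"
    then obtain N where N: "\<forall>n\<ge>N. mdist X ((f ^^ s (r n)) x) l < \<eta>"
      using ev by blast
    have "s (r (max N k)) \<ge> k"
      using s(1)[of "r (max N k)"] seq_suble[OF lr(2), of "max N k"] by simp
    then show "\<exists>n\<ge>k. mdist X l ((f ^^ n) x) < \<eta>"
      using N by (intro exI[of _ "s (r (max N k))"]) (auto simp: mdist_commute)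
  qed
  then show False
    using s(2) ev[OF assms(2)] by (meson leD order_refl)
qed

text \<open>Replace a late orbit segment, leading from near \<open>a\<close> to near \<open>b\<close>, by nearby points of the limit
  set. Uniform continuity makes the result a chain.\<close>
lemma omega_limit_chain_transitive:
  assumes x: "x \<in> mspace X"
  shows "internally_chain_transitive X f (omega_limit X f x)" (is "internally_chain_transitive X f ?Y")
  unfolding internally_chain_transitive_def
proof (intro ballI allI impI)
  fix a b and \<epsilon> :: real assume a: "a \<in> ?Y" and b: "b \<in> ?Y" and e: "\<epsilon> > 0"
  have sub: "?Y \<subseteq> mspace X"
    using mem_omega_limit_iff[OF x] by blast
  obtain \<delta>' where d': "\<delta>' > 0" "\<And>x y. x \<in> mspace X \<Longrightarrow> y \<in> mspace X \<Longrightarrow>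
      mdist X x y < \<delta>' \<Longrightarrow> mdist X (f x) (f y) < \<epsilon>/2"
    using uniformly_continuous[of "\<epsilon>/2"] e by auto
  define \<delta> where "\<delta> = min \<delta>' (\<epsilon>/2)"
  have d: "\<delta> > 0" "\<delta> \<le> \<epsilon>/2" "\<delta> \<le> \<delta>'"
    using d' e by (auto simp: \<delta>_def)
  obtain N where N: "\<And>n. n \<ge> N \<Longrightarrow> \<exists>y\<in>?Y. mdist X ((f ^^ n) x) y < \<delta>"
    using omega_limit_attracts[OF x d(1)] by blast
  obtain p where p: "p \<ge> N" "mdist X a ((f ^^ p) x) < \<delta>"
    using a d(1) unfolding mem_omega_limit_iff[OF x] by blast
  obtain q where q: "q \<ge> Suc p" "mdist X b ((f ^^ q) x) < \<delta>"
    using b d(1) unfolding mem_omega_limit_iff[OF x] by blast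
  have "\<exists>y\<in>?Y. mdist X ((f ^^ (p + n)) x) y < \<delta> \<and> (n = 0 \<longrightarrow> y = a) \<and> (n = q - p \<longrightarrow> y = b)" for n
  proof -
    consider "n = 0" | "n = q - p" | "n \<noteq> 0" "n \<noteq> q - p"
      by blast
    then show ?thesis
    proof cases
      case 1
      then show ?thesis
        using a p q by (intro bexI[of _ a]) (auto simp: mdist_commute)
    next
      case 2
      then show ?thesis
        using b q by (intro bexI[of _ b]) (auto simp: mdist_commute)
    next
      case 3
      then show ?thesis
        using N[of "p + n"] p by auto
    qed
  qed
  then obtain z where z: "\<And>n. z n \<in> ?Y" "\<And>n. mdist X ((f ^^ (p + n)) x) (z n) < \<delta>"
      "z 0 = a" "z (q - p) = b"
    by metis
  have "mdist X (f (z n)) (z (Suc n)) < \<epsilon>" for n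
  proof -
    have "mdist X (f (z n)) (f ((f ^^ (p + n)) x)) < \<epsilon>/2"
      using z(1,2)[of n] sub x d by (intro d') (auto simp: mdist_commute)
    moreover have "mdist X (f ((f ^^ (p + n)) x)) (z (Suc n)) < \<epsilon>/2"
      using z(2)[of "Suc n"] d by simp
    moreover have "z n \<in> mspace X" "z (Suc n) \<in> mspace X"
      using z(1) sub by blast+
    ultimately show ?thesis
      using ms.triangle[of "f (z n)" "f ((f ^^ (p + n)) x)" "z (Suc n)"] x by simp
  qed
  then show "\<exists>m\<ge>1. \<exists>z. pseudo_orbit X f \<epsilon> m z \<and> z 0 = a \<and> z m = b \<and> (\<forall>n\<le>m. z n \<in> ?Y)"
    using z q sub by (intro exI[of _ "q - p"] conjI exI[of _ z]) (auto simp: pseudo_orbit_def)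
qed

section \<open>Limit sets from asymptotic shadowing\<close>

text \<open>A countable dense subset, enumerated with infinitely many repetitions of each of its points.
  The repetitions make every tail of the sequence dense, even near isolated points of \<open>Y\<close>.\<close>
lemma dense_sequence:
  assumes Y: "closedin (mtopology_of X) Y" "Y \<noteq> {}"
  obtains s :: "nat \<Rightarrow> 'a" where "\<forall>n. s n \<in> Y"
    "\<forall>y\<in>Y. \<forall>\<epsilon>>0. \<forall>k. \<exists>n\<ge>k. mdist X (s n) y < \<epsilon>"
proof -
  have "compactin ms.mtopology Y"
    using Y compact closedin_compact_space unfolding mtopology_eq by blast
  then have "ms.mtotally_bounded Y"
    by (rule ms.compactin_imp_mtotally_bounded)
  then have "\<forall>n. \<exists>K. finite K \<and> K \<subseteq> Y \<and> Y \<subseteq> (\<Union>x\<in>K. ms.mball x (1 / Suc n))"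
    unfolding ms.mtotally_bounded_def by simp
  then obtain K where K: "\<And>n. finite (K n)" "\<And>n. K n \<subseteq> Y"
      "\<And>n. Y \<subseteq> (\<Union>x\<in>K n. ms.mball x (1 / Suc n))"
    by metis
  define D where "D = (\<Union>n. K n)"
  have D: "countable D" "D \<subseteq> Y" "D \<noteq> {}"
    using K Y(2) by (auto simp: D_def countable_finite)
  define s where "s n = from_nat_into D (fst (prod_decode n))" for n
  show thesis
  proof
    show "\<forall>n. s n \<in> Y"
      using D from_nat_into[of D] by (auto simp: s_def)
  next
    show "\<forall>y\<in>Y. \<forall>\<epsilon>>0. \<forall>k. \<exists>n\<ge>k. mdist X (s n) y < \<epsilon>"
    proof (intro ballI allI impI)
      fix y and \<epsilon> :: real and k assume "y \<in> Y" "\<epsilon> > 0"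
      then obtain n where n: "1 / real (Suc n) < \<epsilon>"
        using nat_approx_posE by blast
      obtain w where w: "w \<in> K n" "mdist X w y < 1 / Suc n"
        using K(3)[of n] \<open>y \<in> Y\<close> by fastforce
      then obtain j where j: "w = from_nat_into D j"
        using from_nat_into_surj[OF D(1)] by (metis D_def UNIV_I UN_I)
      \<comment> \<open>\<open>prod_decode\<close> repeats every index \<open>j\<close> infinitely often.\<close>
      have "s (prod_encode (j, k)) = w" "prod_encode (j, k) \<ge> k"
        using j le_prod_encode_2 by (auto simp: s_def)
      then show "\<exists>n\<ge>k. mdist X (s n) y < \<epsilon>"
        using w n by (metis order.strict_trans)
    qed
  qed
qed

text \<open>Concatenate chains in \<open>Y\<close>, with errors tending to zero, between consecutive members of a
  sequence all of whose tails are dense.\<close>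
lemma chain_transitive_imp_asymptotic_orbit:
  assumes Y: "closedin (mtopology_of X) Y" "Y \<noteq> {}" and ict: "internally_chain_transitive X f Y"
  obtains z where "\<forall>n. z n \<in> Y" "(\<lambda>n. mdist X (f (z n)) (z (Suc n))) \<longlonglongrightarrow> 0"
    "\<forall>y\<in>Y. \<forall>\<epsilon>>0. \<forall>k. \<exists>n\<ge>k. mdist X (z n) y < \<epsilon>"
proof -
  obtain s :: "nat \<Rightarrow> 'a" where s: "\<forall>n. s n \<in> Y" "\<forall>y\<in>Y. \<forall>\<epsilon>>0. \<forall>k. \<exists>n\<ge>k. mdist X (s n) y < \<epsilon>"
    by (rule dense_sequence[OF Y])
  have "\<exists>m c. m \<ge> 1 \<and> pseudo_orbit X f (1 / Suc k) m c \<and> c 0 = s k \<and> c m = s (Suc k) \<and> (\<forall>n\<le>m. c n \<in> Y)" for k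
    by (rule chain_transitiveE[OF ict s(1)[THEN spec] s(1)[THEN spec], of "1 / real (Suc k)" k "Suc k"]) auto
  then obtain m c where m: "\<And>k. m k \<ge> (1::nat)"
    and po: "\<And>k. pseudo_orbit X f (1 / Suc k) (m k) (c k)"
    and ends: "\<And>k. c k 0 = s k" "\<And>k. c k (m k) = s (Suc k)"
    and cY: "\<And>k n. n \<le> m k \<Longrightarrow> c k n \<in> Y"
    by metis
  \<comment> \<open>The chains are run through one after the other; the state \<open>(k, j)\<close> is position \<open>j\<close> of chain \<open>k\<close>.\<close>
  define advance where "advance = (\<lambda>(k, j). if Suc j < m k then (k, Suc j) else (Suc k, 0))"
  define st where "st n = (advance ^^ n) (0, 0)" for n
  define z where "z n = c (fst (st n)) (snd (st n))" for n
  have st_Suc: "st (Suc n) = advance (st n)" for n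
    by (simp add: st_def)
  have st_less: "snd (st n) < m (fst (st n))" for n
  proof (induction n)
    case 0
    then show ?case
      using m[of 0] by (simp add: st_def)
  next
    case (Suc n)
    then show ?case
      using m[of "Suc (fst (st n))"] by (auto simp: st_Suc advance_def split: prod.splits)
  qed
  have "fst (st n) \<le> fst (st (Suc n))" for n
    by (auto simp: st_Suc advance_def split: prod.splits)
  then have mono: "fst (st n) \<le> fst (st n')" if "n \<le> n'" for n n'
    using that lift_Suc_mono_le[of "\<lambda>n. fst (st n)"] by blast
  have run: "st (n + j) = (k, j)" if "st n = (k, 0)" "j < m k" for n k j
    using that(2) by (induction j) (use that(1) in \<open>auto simp: st_Suc advance_def\<close>)
  have starts: "\<exists>n. st n = (k, 0)" for k
  proof (induction k)
    case 0
    then show ?case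
      by (auto simp: st_def intro: exI[of _ 0])
  next
    case (Suc k)
    then obtain n where "st n = (k, 0)" by blast
    then have "st (n + (m k - 1)) = (k, m k - 1)"
      using m[of k] by (intro run) auto
    then have "st (Suc (n + (m k - 1))) = (Suc k, 0)"
      unfolding st_Suc using m[of k] by (simp add: advance_def)
    then show ?case by blast
  qed
  have jump: "mdist X (f (z n)) (z (Suc n)) < 1 / Suc (fst (st n))" for n
  proof -
    obtain k j where kj: "st n = (k, j)" by fastforce
    then have "j < m k"
      using st_less[of n] by simp
    then have "z (Suc n) = c k (Suc j)"
      using kj ends m[of k] less_antisym[of j "m k"]
      by (cases "Suc j < m k") (auto simp: z_def st_Suc advance_def not_less, metis Suc_leI le_antisym)
    then show ?thesis
      using po[of k] \<open>j < m k\<close> kj by (auto simp: pseudo_orbit_def z_def)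
  qed
  show thesis
  proof
    show "\<forall>n. z n \<in> Y"
      using cY st_less by (simp add: z_def less_imp_le)
    show "(\<lambda>n. mdist X (f (z n)) (z (Suc n))) \<longlonglongrightarrow> 0"
    proof (rule LIMSEQ_I)
      fix r :: real assume "r > 0"
      then obtain k where k: "1 / real (Suc k) < r"
        using nat_approx_posE by blast
      obtain N where N: "st N = (k, 0)"
        using starts by blast
      have "norm (mdist X (f (z n)) (z (Suc n)) - 0) < r" if "n \<ge> N" for n
      proof -
        have "k \<le> fst (st n)"
          using mono[OF that] N by simp
        then have "1 / real (Suc (fst (st n))) \<le> 1 / real (Suc k)"
          by (intro divide_left_mono) auto
        then show ?thesis
          using jump[of n] k by simp
      qed
      then show "\<exists>no. \<forall>n\<ge>no. norm (mdist X (f (z n)) (z (Suc n)) - 0) < r"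
        by blast
    qed
  next
    show "\<forall>y\<in>Y. \<forall>\<epsilon>>0. \<forall>k. \<exists>n\<ge>k. mdist X (z n) y < \<epsilon>"
    proof (intro ballI allI impI)
      fix y and \<epsilon> :: real and k assume "y \<in> Y" "\<epsilon> > 0"
      define K where "K = Suc (fst (st k))"
      obtain i where i: "i \<ge> K" "mdist X (s i) y < \<epsilon>"
        using s(2) \<open>y \<in> Y\<close> \<open>\<epsilon> > 0\<close> by blast
      obtain n where n: "st n = (i, 0)"
        using starts by blast
      have "k \<le> n"
        using mono[of n k] n i(1) by (simp add: K_def) (meson Suc_n_not_le_n le_trans nat_le_linear)
      moreover have "z n = s i"
        using n ends by (simp add: z_def)
      ultimately show "\<exists>n\<ge>k. mdist X (z n) y < \<epsilon>"
        using i by auto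
    qed
  qed
qed

text \<open>The uniform bound \<open>\<delta>\<close> on the errors costs nothing for limit sets, which only see
  tails, and spares the proofs of shadowing the treatment of finitely many bad errors.\<close>
definition asymptotic_shadowing :: "'a set \<Rightarrow> bool" where
  "asymptotic_shadowing Y \<longleftrightarrow> (\<exists>\<delta>>0. \<forall>z. (\<forall>n. z n \<in> Y \<and> mdist X (f (z n)) (z (Suc n)) < \<delta>) \<and>
     (\<lambda>n. mdist X (f (z n)) (z (Suc n))) \<longlonglongrightarrow> 0 \<longrightarrow>
     (\<exists>x\<in>mspace X. (\<lambda>n. mdist X ((f ^^ n) x) (z n)) \<longlonglongrightarrow> 0))"

text \<open>Dropping finitely many terms of an asymptotic orbit brings all errors below \<open>\<delta>\<close>. An orbit that
  is asymptotic to the rest accumulates on all of \<open>Y\<close>, because tails are dense, and nowhere else,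
  because \<open>Y\<close> is closed.\<close>
lemma shadowing_imp_omega_limit:
  assumes Y: "closedin (mtopology_of X) Y" "Y \<noteq> {}" and ict: "internally_chain_transitive X f Y"
    and shadow: "asymptotic_shadowing Y"
  shows "\<exists>x\<in>mspace X. Y = omega_limit X f x"
proof -
  have sub: "Y \<subseteq> mspace X"
    using closedin_subset[OF Y(1)] by simp
  obtain \<delta> where d: "\<delta> > 0" "\<And>z. (\<And>n. z n \<in> Y \<and> mdist X (f (z n)) (z (Suc n)) < \<delta>) \<Longrightarrow>
     (\<lambda>n. mdist X (f (z n)) (z (Suc n))) \<longlonglongrightarrow> 0 \<Longrightarrow>
     \<exists>x\<in>mspace X. (\<lambda>n. mdist X ((f ^^ n) x) (z n)) \<longlonglongrightarrow> 0"
    using shadow unfolding asymptotic_shadowing_def by blast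
  obtain z where zY: "\<forall>n. z n \<in> Y" and z: "(\<lambda>n. mdist X (f (z n)) (z (Suc n))) \<longlonglongrightarrow> 0"
    and dense: "\<forall>y\<in>Y. \<forall>\<epsilon>>0. \<forall>k. \<exists>n\<ge>k. mdist X (z n) y < \<epsilon>"
    by (rule chain_transitive_imp_asymptotic_orbit[OF Y ict])
  note z = zY[THEN spec] z
  obtain N where N: "\<And>n. n \<ge> N \<Longrightarrow> mdist X (f (z n)) (z (Suc n)) < \<delta>"
    using order_tendstoD(2)[OF z(2) d(1)] by (auto simp: eventually_sequentially)
  obtain x where x: "x \<in> mspace X" "(\<lambda>n. mdist X ((f ^^ n) x) (z (n + N))) \<longlonglongrightarrow> 0"
    using d(2)[of "\<lambda>n. z (n + N)"] z N LIMSEQ_ignore_initial_segment[OF z(2), of N] by auto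
  have near: "\<exists>K. \<forall>n\<ge>K. mdist X ((f ^^ n) x) (z (n + N)) < \<epsilon>" if "\<epsilon> > 0" for \<epsilon>
    using order_tendstoD(2)[OF x(2) that] by (simp add: eventually_sequentially)
  have "y \<in> Y" if y: "y \<in> omega_limit X f x" for y
  proof (rule mem_closedI[OF Y(1)])
    show ymem: "y \<in> mspace X"
      using y mem_omega_limit_iff[OF x(1)] by blast
    fix \<epsilon> :: real assume "\<epsilon> > 0"
    then obtain K where K: "\<forall>n\<ge>K. mdist X ((f ^^ n) x) (z (n + N)) < \<epsilon>/2"
      using near[of "\<epsilon>/2"] by auto
    obtain n where n: "n \<ge> K" "mdist X y ((f ^^ n) x) < \<epsilon>/2"
      using y \<open>\<epsilon> > 0\<close> unfolding mem_omega_limit_iff[OF x(1)] by (meson half_gt_zero)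
    have "mdist X y (z (n + N)) \<le> mdist X y ((f ^^ n) x) + mdist X ((f ^^ n) x) (z (n + N))"
      using ms.triangle ymem x(1) z(1) sub by (meson funpow_in subsetD)
    moreover have "mdist X ((f ^^ n) x) (z (n + N)) < \<epsilon>/2"
      using K n(1) by blast
    ultimately show "\<exists>w\<in>Y. mdist X y w < \<epsilon>"
      using n z(1) by (intro bexI[of _ "z (n + N)"]) auto
  qed
  moreover have "y \<in> omega_limit X f x" if y: "y \<in> Y" for y
    unfolding mem_omega_limit_iff[OF x(1)]
  proof (intro conjI allI impI)
    show "y \<in> mspace X"
      using sub y by blast
    fix \<epsilon> :: real and k assume "\<epsilon> > 0"
    then obtain K where K: "\<forall>n\<ge>K. mdist X ((f ^^ n) x) (z (n + N)) < \<epsilon>/2"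
      using near[of "\<epsilon>/2"] by auto
    obtain n' where n': "n' \<ge> max K k + N" "mdist X (z n') y < \<epsilon>/2"
      using dense y \<open>\<epsilon> > 0\<close> by (meson half_gt_zero)
    define n where "n = n' - N"
    have n: "n \<ge> K" "n \<ge> k" "n + N = n'"
      using n' by (auto simp: n_def)
    have "mdist X ((f ^^ n) x) y \<le> mdist X ((f ^^ n) x) (z n') + mdist X (z n') y"
      using ms.triangle y x(1) z(1) sub by (meson funpow_in subsetD)
    moreover have "mdist X ((f ^^ n) x) (z n') < \<epsilon>/2"
      using K n by blast
    ultimately show "\<exists>n\<ge>k. mdist X y ((f ^^ n) x) < \<epsilon>"
      using n n' by (intro exI[of _ n]) (auto simp: mdist_commute)
  qed
  ultimately show ?thesis
    using x(1) by blast
qed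

lemma limit_set_characterization:
  assumes Y: "closedin (mtopology_of X) Y" "Y \<noteq> {}"
    and shadow: "internally_chain_transitive X f Y \<Longrightarrow> asymptotic_shadowing Y"
  shows "((\<forall>p. Y = {p} \<longrightarrow> f p = p) \<longrightarrow>
      (weakly_incompressible X f Y \<longleftrightarrow> internally_chain_transitive X f Y)) \<and>
    (internally_chain_transitive X f Y \<longleftrightarrow> (\<exists>x\<in>mspace X. Y = omega_limit X f x))"
  using chain_transitive_imp_weakly_incompressible[OF Y(1)]
    weakly_incompressible_imp_chain_transitive[OF Y(1)]
    shadowing_imp_omega_limit[OF Y _ shadow] omega_limit_chain_transitive by blast

end

section \<open>Shadowing by expanding lifts\<close>

text \<open>The supremum \<open>S\<close> of a late tail of \<open>a\<close> satisfies \<open>\<kappa> * S \<le> c + S\<close> with \<open>c\<close> a bound for the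
  errors; as \<open>\<kappa> > 1\<close>, \<open>S\<close> is small with \<open>c\<close>.\<close>
lemma expansion_recursion_tendsto_zero:
  fixes a e :: "nat \<Rightarrow> real"
  assumes "\<kappa> > 1" "e \<longlonglongrightarrow> 0" and nonneg: "\<And>n. a n \<ge> 0" and bound: "\<And>n. a n \<le> B"
    and rec: "\<And>n. \<kappa> * a n \<le> e n + a (Suc n)"
  shows "a \<longlonglongrightarrow> 0"
proof (rule LIMSEQ_I)
  fix r :: real assume "r > 0"
  define c where "c = r * (\<kappa> - 1) / 2"
  have "c > 0"
    using \<open>r > 0\<close> assms(1) by (simp add: c_def)
  then obtain N where N: "\<And>n. n \<ge> N \<Longrightarrow> e n < c"
    using order_tendstoD(2)[OF assms(2)] by (auto simp: eventually_sequentially)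
  define S where "S = (SUP n\<in>{N..}. a n)"
  have S: "a n \<le> S" if "n \<ge> N" for n
    unfolding S_def using that bound by (intro cSUP_upper bdd_aboveI2[of _ _ B]) auto
  have "a n \<le> (c + S) / \<kappa>" if "n \<ge> N" for n
    using rec[of n] N[OF that] S[of "Suc n"] that assms(1) by (simp add: field_simps)
  then have "S \<le> (c + S) / \<kappa>"
    unfolding S_def by (intro cSUP_least) auto
  then have "(\<kappa> - 1) * S \<le> (\<kappa> - 1) * (r / 2)"
    using assms(1) by (simp add: c_def field_simps)
  then have "S \<le> r / 2"
    using assms(1) by simp
  then have "norm (a n - 0) < r" if "n \<ge> N" for n
    using S[OF that] nonneg[of n] \<open>r > 0\<close> by simp
  then show "\<exists>no. \<forall>n\<ge>no. norm (a n - 0) < r"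
    by blast
qed

context compact_dynamics
begin

lemma image_tendsto:
  assumes "\<And>k. s k \<in> mspace X" "l \<in> mspace X" "(\<lambda>k. mdist X (s k) l) \<longlonglongrightarrow> 0"
  shows "(\<lambda>k. mdist X (f (s k)) (f l)) \<longlonglongrightarrow> 0"
proof (rule LIMSEQ_I)
  fix r :: real assume "r > 0"
  then obtain d where d: "d > 0" "\<And>x y. x \<in> mspace X \<Longrightarrow> y \<in> mspace X \<Longrightarrow>
      mdist X x y < d \<Longrightarrow> mdist X (f x) (f y) < r"
    using uniformly_continuous by metis
  obtain N where "\<forall>n\<ge>N. mdist X (s n) l < d"
    using order_tendstoD(2)[OF assms(3) d(1)] by (auto simp: eventually_sequentially)
  then have "norm (mdist X (f (s n)) (f l) - 0) < r" if "n \<ge> N" for n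
    using d(2)[OF assms(1,2)] that by simp
  then show "\<exists>no. \<forall>n\<ge>no. norm (mdist X (f (s n)) (f l) - 0) < r"
    by blast
qed

lemma funpow_tendsto:
  assumes "\<And>k. s k \<in> mspace X" "l \<in> mspace X" "(\<lambda>k. mdist X (s k) l) \<longlonglongrightarrow> 0"
  shows "(\<lambda>k. mdist X ((f ^^ n) (s k)) ((f ^^ n) l)) \<longlonglongrightarrow> 0"
proof (induction n)
  case (Suc n)
  then show ?case
    using image_tendsto[of "\<lambda>k. (f ^^ n) (s k)" "(f ^^ n) l"] assms(1,2) by simp
qed (use assms(3) in simp)

lemma mdist_tendsto:
  assumes "\<And>k. s k \<in> mspace X" "l \<in> mspace X" "(\<lambda>k. mdist X (s k) l) \<longlonglongrightarrow> 0" "z \<in> mspace X"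
  shows "(\<lambda>k. mdist X z (s k)) \<longlonglongrightarrow> mdist X z l"
proof -
  have "\<bar>mdist X z (s k) - mdist X z l\<bar> \<le> mdist X (s k) l" for k
    using ms.mdist_reverse_triangle[of "s k" z l] assms by (simp add: mdist_commute[of X z])
  then have "(\<lambda>k. mdist X z (s k) - mdist X z l) \<longlonglongrightarrow> 0"
    by (intro Lim_null_comparison[OF always_eventually assms(3)]) simp
  then show ?thesis
    using LIM_zero_iff by blast
qed

text \<open>Shadow the last point by itself and pull back along the pseudo-orbit. If \<open>w\<close> shadows
  \<open>z (Suc n)\<close> within \<open>\<delta> / \<kappa>\<close>, it lies within \<open>(\<delta> - \<delta> / \<kappa>) + \<delta> / \<kappa> = \<delta>\<close> of
  \<open>f (z n)\<close>, so it can be lifted, and the lift is within \<open>\<delta> / \<kappa>\<close> of \<open>z n\<close>. The induction removes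
  the first point of the pseudo-orbit, which is why \<open>z\<close> is arbitrary.\<close>
lemma finite_shadowing:
  assumes sub: "Y \<subseteq> mspace X" and "\<kappa> > 1"
    and lift: "\<And>x y. x \<in> Y \<Longrightarrow> y \<in> mspace X \<Longrightarrow> mdist X (f x) y < \<delta> \<Longrightarrow>
      \<exists>x'\<in>mspace X. f x' = y \<and> \<kappa> * mdist X x x' \<le> mdist X (f x) y"
    and z: "\<And>n. z n \<in> Y" "\<And>n. mdist X (f (z n)) (z (Suc n)) < \<delta> - \<delta> / \<kappa>"
    and "\<delta> > 0"
  shows "\<exists>x\<in>mspace X. (\<forall>n\<le>N. mdist X (z n) ((f ^^ n) x) \<le> \<delta> / \<kappa>) \<and>
    (\<forall>n<N. \<kappa> * mdist X (z n) ((f ^^ n) x) \<le>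
       mdist X (f (z n)) (z (Suc n)) + mdist X (z (Suc n)) ((f ^^ Suc n) x))"
  using z
proof (induction N arbitrary: z)
  case 0
  have "z 0 \<in> mspace X"
    using 0 sub by blast
  then show ?case
    using assms by (intro bexI[of _ "z 0"]) auto
next
  case (Suc N)
  obtain x where x: "x \<in> mspace X" "\<And>n. n \<le> N \<Longrightarrow> mdist X (z (Suc n)) ((f ^^ n) x) \<le> \<delta> / \<kappa>"
    "\<And>n. n < N \<Longrightarrow> \<kappa> * mdist X (z (Suc n)) ((f ^^ n) x) \<le>
       mdist X (f (z (Suc n))) (z (Suc (Suc n))) + mdist X (z (Suc (Suc n))) ((f ^^ Suc n) x)"
    using Suc.IH[of "\<lambda>n. z (Suc n)"] Suc.prems by blast
  have tri: "mdist X (f (z 0)) x \<le> mdist X (f (z 0)) (z 1) + mdist X (z 1) x"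
    using ms.triangle[of "f (z 0)" "z 1" x] x(1) Suc.prems(1) sub by (simp add: subset_iff)
  then have less: "mdist X (f (z 0)) x < \<delta>"
    using Suc.prems(2)[of 0] x(2)[of 0] by simp
  then obtain x' where x': "x' \<in> mspace X" "f x' = x" "\<kappa> * mdist X (z 0) x' \<le> mdist X (f (z 0)) x"
    using lift[OF Suc.prems(1) x(1)] by blast
  have pow: "(f ^^ Suc n) x' = (f ^^ n) x" for n
    using x'(2) by (simp add: funpow_swap1)
  have "mdist X (z n) ((f ^^ n) x') \<le> \<delta> / \<kappa>" if "n \<le> Suc N" for n
  proof (cases n)
    case 0
    have "\<kappa> * mdist X (z 0) x' \<le> \<delta>"
      using x'(3) less by simp
    then show ?thesis
      using 0 assms(2) by (simp add: field_simps)
  next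
    case (Suc k)
    then show ?thesis
      using x(2)[of k] that pow[of k] by simp
  qed
  moreover have "\<kappa> * mdist X (z n) ((f ^^ n) x') \<le>
       mdist X (f (z n)) (z (Suc n)) + mdist X (z (Suc n)) ((f ^^ Suc n) x')" if "n < Suc N" for n
  proof (cases n)
    case 0
    then show ?thesis
      using x'(2,3) tri by simp
  next
    case (Suc k)
    then show ?thesis
      using x(3)[of k] that pow[of k] pow[of "Suc k"] by simp
  qed
  ultimately show ?case
    using x'(1) by blast
qed

text \<open>A limit point of the initial points that shadow longer and longer segments shadows the whole
  pseudo-orbit. The recursive estimate between consecutive distances survives the limit and
  forces the distances to zero.\<close>
lemma expanding_lifts_imp_asymptotic_shadowing:
  assumes sub: "Y \<subseteq> mspace X" and "\<kappa> > 1" "\<delta> > 0"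
    and lift: "\<And>x y. x \<in> Y \<Longrightarrow> y \<in> mspace X \<Longrightarrow> mdist X (f x) y < \<delta> \<Longrightarrow>
      \<exists>x'\<in>mspace X. f x' = y \<and> \<kappa> * mdist X x x' \<le> mdist X (f x) y"
  shows "asymptotic_shadowing Y"
  unfolding asymptotic_shadowing_def
proof (intro exI[of _ "\<delta> - \<delta> / \<kappa>"] conjI allI impI)
  show "0 < \<delta> - \<delta> / \<kappa>"
    using assms(2,3) by (simp add: field_simps)
  fix z assume "(\<forall>n. z n \<in> Y \<and> mdist X (f (z n)) (z (Suc n)) < \<delta> - \<delta> / \<kappa>) \<and>
     (\<lambda>n. mdist X (f (z n)) (z (Suc n))) \<longlonglongrightarrow> 0"
  then have z: "\<And>n. z n \<in> Y" "\<And>n. mdist X (f (z n)) (z (Suc n)) < \<delta> - \<delta> / \<kappa>"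
    and lim: "(\<lambda>n. mdist X (f (z n)) (z (Suc n))) \<longlonglongrightarrow> 0"
    by auto
  have zX: "z n \<in> mspace X" for n
    using z(1) sub by blast
  have "\<forall>N. \<exists>x. x \<in> mspace X \<and> (\<forall>n\<le>N. mdist X (z n) ((f ^^ n) x) \<le> \<delta> / \<kappa>) \<and>
    (\<forall>n<N. \<kappa> * mdist X (z n) ((f ^^ n) x) \<le>
       mdist X (f (z n)) (z (Suc n)) + mdist X (z (Suc n)) ((f ^^ Suc n) x))"
    using finite_shadowing[where z = z and Y = Y, OF sub assms(2) lift z assms(3)] by blast
  then obtain s where s: "\<And>N. s N \<in> mspace X" "\<And>N n. n \<le> N \<Longrightarrow> mdist X (z n) ((f ^^ n) (s N)) \<le> \<delta> / \<kappa>"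
    "\<And>N n. n < N \<Longrightarrow> \<kappa> * mdist X (z n) ((f ^^ n) (s N)) \<le>
       mdist X (f (z n)) (z (Suc n)) + mdist X (z (Suc n)) ((f ^^ Suc n) (s N))"
    by metis
  obtain x r where xr: "x \<in> mspace X" "strict_mono (r :: nat \<Rightarrow> nat)" "(\<lambda>k. mdist X (s (r k)) x) \<longlonglongrightarrow> 0"
    by (rule convergent_subsequence[of s, OF s(1)])
  have conv: "(\<lambda>k. mdist X (z j) ((f ^^ n) (s (r k)))) \<longlonglongrightarrow> mdist X (z j) ((f ^^ n) x)" for n j
    using s(1) xr zX by (intro mdist_tendsto funpow_tendsto) auto
  define a where "a n = mdist X (z n) ((f ^^ n) x)" for n
  have ge: "r k \<ge> k" for k
    using seq_suble[OF xr(2)] .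
  have "a \<longlonglongrightarrow> 0"
  proof (rule expansion_recursion_tendsto_zero[OF assms(2) lim])
    fix n
    show "a n \<ge> 0"
      by (simp add: a_def)
    have "mdist X (z n) ((f ^^ n) (s (r k))) \<le> \<delta> / \<kappa>" if "k \<ge> n" for k
      using s(2) ge[of k] that by simp
    then show "a n \<le> \<delta> / \<kappa>"
      unfolding a_def by (intro LIMSEQ_le_const2[OF conv]) blast
    have "\<kappa> * mdist X (z n) ((f ^^ n) (s (r k))) \<le>
       mdist X (f (z n)) (z (Suc n)) + mdist X (z (Suc n)) ((f ^^ Suc n) (s (r k)))" if "k \<ge> Suc n" for k
      using s(3)[of n "r k"] ge[of k] that by simp
    then show "\<kappa> * a n \<le> mdist X (f (z n)) (z (Suc n)) + a (Suc n)"
      unfolding a_def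
      by (intro LIMSEQ_le[OF tendsto_mult[OF tendsto_const conv[of n n]]
            tendsto_add[OF tendsto_const conv[of "Suc n" "Suc n"]]]) blast
  qed
  then show "\<exists>x\<in>mspace X. (\<lambda>n. mdist X ((f ^^ n) x) (z n)) \<longlonglongrightarrow> 0"
    using xr(1) unfolding a_def by (auto simp: mdist_commute)
qed

end

section \<open>Expanding piecewise linear maps\<close>

text \<open>One-sided behaviour at \<open>x\<close> in the direction \<open>h\<close>, which is \<open>1\<close> or \<open>-1\<close>. The slope \<open>a\<close> is taken
  with respect to the distance from \<open>x\<close>, so on the left it is the negative of the gradient;
  this makes the two sides symmetric.\<close>
definition affine_germ :: "(real \<Rightarrow> real) \<Rightarrow> real \<Rightarrow> real \<Rightarrow> real \<Rightarrow> real \<Rightarrow> bool" where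
  "affine_germ f x h \<rho> a \<longleftrightarrow> \<rho> > 0 \<and> (\<forall>t\<in>{0..\<rho>}. x + h * t \<in> {0..1} \<and> f (x + h * t) = f x + a * t)"

lemma ex_piece_right:
  fixes c :: "nat \<Rightarrow> real"
  assumes "c 0 \<le> x" "x < c m"
  shows "\<exists>i<m. c i \<le> x \<and> x < c (Suc i)"
  using assms
proof (induction m)
  case (Suc m)
  then show ?case
    by (cases "x < c m") (auto simp: less_Suc_eq)
qed simp

lemma ex_piece_left:
  fixes c :: "nat \<Rightarrow> real"
  assumes "c 0 < x" "x \<le> c m"
  shows "\<exists>i<m. c i < x \<and> x \<le> c (Suc i)"
  using assms
proof (induction m)
  case (Suc m)
  then show ?case
    by (cases "x \<le> c m") (auto simp: less_Suc_eq)
qed simp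

lemma affine_germ_right:
  assumes pl: "linear_pieces f m c g" and x: "0 \<le> x" "x < 1"
  obtains i \<rho> where "i < m" "affine_germ f x 1 \<rho> (g i)"
proof -
  obtain i where i: "i < m" "c i \<le> x" "x < c (Suc i)"
    using ex_piece_right[of c x m] pl x by (auto simp: linear_pieces_def)
  then obtain b where b: "\<And>y. y \<in> {c i..c (Suc i)} \<Longrightarrow> f y = g i * y + b"
    using pl unfolding linear_pieces_def by blast
  have "affine_germ f x 1 (min (c (Suc i) - x) (1 - x)) (g i)"
    unfolding affine_germ_def using i x by (auto simp: b algebra_simps)
  then show thesis
    using that i by blast
qed

lemma affine_germ_left:
  assumes pl: "linear_pieces f m c g" and x: "0 < x" "x \<le> 1"
  obtains i \<rho> where "i < m" "affine_germ f x (-1) \<rho> (- g i)"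
proof -
  obtain i where i: "i < m" "c i < x" "x \<le> c (Suc i)"
    using ex_piece_left[of c x m] pl x by (auto simp: linear_pieces_def)
  then obtain b where b: "\<And>y. y \<in> {c i..c (Suc i)} \<Longrightarrow> f y = g i * y + b"
    using pl unfolding linear_pieces_def by blast
  have "affine_germ f x (-1) (min (x - c i) x) (- g i)"
    unfolding affine_germ_def using i x by (auto simp: b algebra_simps)
  then show thesis
    using that i by blast
qed

text \<open>A preimage of \<open>y\<close> to which \<open>x\<close> can be moved without losing the expansion factor \<open>\<kappa>\<close>.\<close>
definition liftable :: "(real \<Rightarrow> real) \<Rightarrow> real \<Rightarrow> real \<Rightarrow> real \<Rightarrow> bool" where
  "liftable f \<kappa> x y \<longleftrightarrow> (\<exists>x'\<in>{0..1}. f x' = y \<and> \<kappa> * \<bar>x' - x\<bar> \<le> \<bar>y - f x\<bar>)"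

text \<open>The sign condition says that the affine continuation of the germ at \<open>x\<close> takes the value \<open>y\<close> on
  the side \<open>h\<close>, and it does so within the domain of the germ because \<open>y\<close> is close
  to \<open>f (x + h * t)\<close> and \<open>f\<close> expands.\<close>
lemma liftable_same_side:
  assumes germ: "affine_germ f x h \<rho> a" and h: "\<bar>h\<bar> = 1" and a: "\<bar>a\<bar> \<ge> \<kappa>" "\<kappa> > 1"
    and t: "0 \<le> t" "t < \<rho> / 2" and y: "\<bar>y - f (x + h * t)\<bar> < \<rho> / 2" "(y - f x) / a \<ge> 0"
  shows "liftable f \<kappa> (x + h * t) y"
proof -
  define t' where "t' = (y - f x) / a"
  have fx: "f (x + h * t) = f x + a * t"
    using germ t by (simp add: affine_germ_def)
  have diff: "y - f (x + h * t) = a * (t' - t)"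
    using a unfolding fx t'_def by (simp add: field_simps)
  have le: "\<kappa> * \<bar>t' - t\<bar> \<le> \<bar>y - f (x + h * t)\<bar>"
    unfolding diff abs_mult using a by (intro mult_right_mono) auto
  have "\<bar>t' - t\<bar> \<le> \<kappa> * \<bar>t' - t\<bar>"
    using a mult_right_mono[of 1 \<kappa> "\<bar>t' - t\<bar>"] by simp
  also note le
  also note y(1)
  finally have "\<bar>t' - t\<bar> < \<rho> / 2" .
  then have "t' \<le> \<rho>" "t' \<ge> 0"
    using y(2) t(2) unfolding t'_def[symmetric] by linarith+
  then have "x + h * t' \<in> {0..1}" "f (x + h * t') = f x + a * t'"
    using germ by (auto simp: affine_germ_def)
  moreover have "f x + a * t' = y"
    using a by (simp add: t'_def)
  moreover have "\<bar>x + h * t' - (x + h * t)\<bar> = \<bar>t' - t\<bar>"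
    using h by (metis abs_mult add_diff_cancel_left mult_1 right_diff_distrib)
  ultimately show ?thesis
    using le unfolding liftable_def by (intro bexI[of _ "x + h * t'"]) auto
qed

text \<open>If \<open>f\<close> crosses the value \<open>f x\<close> at \<open>x\<close>, a value beyond \<open>f x\<close> is taken on the other side of \<open>x\<close>.
  The path through \<open>x\<close> is monotone, so its image has length \<open>\<bar>y - f (x + h * t)\<bar>\<close>.\<close>
lemma liftable_other_side:
  assumes germ: "affine_germ f x h \<rho> a" "affine_germ f x (- h) \<rho>' b" and h: "\<bar>h\<bar> = 1"
    and a: "\<bar>a\<bar> \<ge> \<kappa>" "\<bar>b\<bar> \<ge> \<kappa>" "\<kappa> > 1" and ab: "a * b < 0"
    and t: "0 \<le> t" "t \<le> \<rho>" and y: "\<bar>y - f (x + h * t)\<bar> < \<rho>'" "(y - f x) / a < 0"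
  shows "liftable f \<kappa> (x + h * t) y"
proof -
  define t' where "t' = (y - f x) / b"
  have "t' > 0"
    using ab y(2) unfolding t'_def by (auto simp: mult_less_0_iff divide_less_0_iff zero_less_divide_iff)
  have fx: "f (x + h * t) = f x + a * t"
    using germ t by (simp add: affine_germ_def)
  have diff: "y - f (x + h * t) = b * t' - a * t"
    using a unfolding fx t'_def by (simp add: field_simps)
  \<comment> \<open>Opposite signs of \<open>a\<close> and \<open>b\<close> make the two contributions add up.\<close>
  have "\<bar>b * t' - a * t\<bar> = \<bar>b\<bar> * t' + \<bar>a\<bar> * t"
  proof (cases "a > 0")
    case True
    then have "b < 0"
      using ab by (simp add: mult_less_0_iff)
    then have "b * t' \<le> 0" "a * t \<ge> 0"
      using \<open>t' > 0\<close> t True by (auto simp: mult_le_0_iff)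
    then show ?thesis
      using True \<open>b < 0\<close> by simp
  next
    case False
    then have "b > 0" "a < 0"
      using ab by (auto simp: mult_less_0_iff)
    then have "b * t' \<ge> 0" "a * t \<le> 0"
      using \<open>t' > 0\<close> t by (auto simp: mult_le_0_iff)
    then show ?thesis
      using \<open>b > 0\<close> \<open>a < 0\<close> by simp
  qed
  moreover have "\<kappa> * t' \<le> \<bar>b\<bar> * t'" "\<kappa> * t \<le> \<bar>a\<bar> * t"
    using a \<open>t' > 0\<close> t by (auto intro: mult_right_mono)
  ultimately have le: "\<kappa> * (t + t') \<le> \<bar>y - f (x + h * t)\<bar>"
    unfolding diff by (simp add: distrib_left)
  have "1 * (t + t') \<le> \<kappa> * (t + t')"
    using a \<open>t' > 0\<close> t by (intro mult_right_mono) auto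
  then have "t' \<le> \<rho>'"
    using le y t by simp
  then have "x + (- h) * t' \<in> {0..1}" "f (x + (- h) * t') = f x + b * t'"
    using germ(2) \<open>t' > 0\<close> unfolding affine_germ_def by auto
  moreover have "f x + b * t' = y"
    using a by (simp add: t'_def)
  moreover have "\<bar>x + (- h) * t' - (x + h * t)\<bar> = t + t'"
  proof -
    have "x + (- h) * t' - (x + h * t) = - (h * (t + t'))"
      by (simp add: algebra_simps)
    then show ?thesis
      using h t \<open>t' > 0\<close> by (simp add: abs_mult)
  qed
  ultimately show ?thesis
    using le unfolding liftable_def by (intro bexI[of _ "x + (- h) * t'"]) auto
qed

text \<open>At a value \<open>0\<close> or \<open>1\<close> the graph folds, but all points of the interval lie on the side of the
  fold to which \<open>f\<close> maps, so the other side is never asked for.\<close>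
lemma liftable_at_extreme_value:
  assumes germ: "affine_germ f x h \<rho> a" and h: "\<bar>h\<bar> = 1" and a: "\<bar>a\<bar> \<ge> \<kappa>" "\<kappa> > 1"
    and f: "f ` {0..1} \<subseteq> {0..1}" "f x \<in> {0, 1}"
    and t: "0 \<le> t" "t < \<rho> / 2" and y: "y \<in> {0..1}" "\<bar>y - f (x + h * t)\<bar> < \<rho> / 2"
  shows "liftable f \<kappa> (x + h * t) y"
proof (rule liftable_same_side[OF germ h a t y(2)])
  have \<rho>: "\<rho> > 0" "x + h * \<rho> \<in> {0..1}" "f (x + h * \<rho>) = f x + a * \<rho>"
    using germ unfolding affine_germ_def by auto
  have "f (x + h * \<rho>) \<in> {0..1}"
    using f(1) \<rho>(2) by blast
  then have "f x + a * \<rho> \<in> {0..1}"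
    using \<rho>(3) by simp
  then show "(y - f x) / a \<ge> 0"
    using f(2) y(1) \<rho>(1) a
    by (auto simp: zero_le_divide_iff zero_le_mult_iff mult_le_0_iff)
qed

lemma local_extremumI:
  assumes "x \<in> {0..1}" "r > 0"
    and "(\<forall>y\<in>{0..1}. \<bar>y - x\<bar> < r \<longrightarrow> f y \<le> f x) \<or> (\<forall>y\<in>{0..1}. \<bar>y - x\<bar> < r \<longrightarrow> f y \<ge> f x)"
  shows "local_extremum f x"
proof -
  have "eventually P (at x within {0..1})" if "\<forall>y\<in>{0..1}. \<bar>y - x\<bar> < r \<longrightarrow> P y" for P
    unfolding eventually_at dist_real_def using that assms(2) by blast
  from this[of "\<lambda>y. f y \<le> f x"] this[of "\<lambda>y. f y \<ge> f x"] show ?thesis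
    using assms(1,3) unfolding local_extremum_def by argo
qed

lemma affine_germ_sign:
  assumes "affine_germ f x h \<rho> a" "0 \<le> t" "t \<le> \<rho>"
  shows "a \<ge> 0 \<Longrightarrow> f (x + h * t) \<ge> f x" "a \<le> 0 \<Longrightarrow> f (x + h * t) \<le> f x"
  using assms by (auto simp: affine_germ_def mult_le_0_iff)

lemma local_extremum_0:
  assumes "affine_germ f 0 1 \<rho> a"
  shows "local_extremum f 0"
proof (rule local_extremumI)
  show "\<rho> > 0"
    using assms by (simp add: affine_germ_def)
  show "(\<forall>y\<in>{0..1}. \<bar>y - 0\<bar> < \<rho> \<longrightarrow> f y \<le> f 0) \<or> (\<forall>y\<in>{0..1}. \<bar>y - 0\<bar> < \<rho> \<longrightarrow> f y \<ge> f 0)"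
    using affine_germ_sign[OF assms] by (cases "a \<ge> 0") auto
qed auto

lemma local_extremum_1:
  assumes "affine_germ f 1 (-1) \<rho> a"
  shows "local_extremum f 1"
proof (rule local_extremumI)
  show "\<rho> > 0"
    using assms by (simp add: affine_germ_def)
  have "(a \<ge> 0 \<longrightarrow> f y \<ge> f 1) \<and> (a \<le> 0 \<longrightarrow> f y \<le> f 1)" if "y \<in> {0..1}" "\<bar>y - 1\<bar> < \<rho>" for y
    using affine_germ_sign[OF assms, of "1 - y"] that by auto
  then show "(\<forall>y\<in>{0..1}. \<bar>y - 1\<bar> < \<rho> \<longrightarrow> f y \<le> f 1) \<or> (\<forall>y\<in>{0..1}. \<bar>y - 1\<bar> < \<rho> \<longrightarrow> f y \<ge> f 1)"
    by (cases "a \<ge> 0") auto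
qed auto

lemma local_extremum_interior:
  assumes x: "x \<in> {0..1}" and germ: "affine_germ f x 1 \<rho> a" "affine_germ f x (-1) \<rho>' b"
    and ab: "a * b \<ge> 0"
  shows "local_extremum f x"
proof (rule local_extremumI[OF x])
  show "min \<rho> \<rho>' > 0"
    using germ by (simp add: affine_germ_def)
  have sgn: "(a \<ge> 0 \<and> b \<ge> 0 \<longrightarrow> f y \<ge> f x) \<and> (a \<le> 0 \<and> b \<le> 0 \<longrightarrow> f y \<le> f x)"
    if "y \<in> {0..1}" "\<bar>y - x\<bar> < min \<rho> \<rho>'" for y
  proof (cases "y \<ge> x")
    case True
    then show ?thesis
      using affine_germ_sign[OF germ(1), of "y - x"] that by auto
  next
    case False
    then show ?thesis
      using affine_germ_sign[OF germ(2), of "x - y"] that by auto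
  qed
  show "(\<forall>y\<in>{0..1}. \<bar>y - x\<bar> < min \<rho> \<rho>' \<longrightarrow> f y \<le> f x) \<or> (\<forall>y\<in>{0..1}. \<bar>y - x\<bar> < min \<rho> \<rho>' \<longrightarrow> f y \<ge> f x)"
    using ab sgn unfolding zero_le_mult_iff by blast
qed

text \<open>Lifts can fail only where \<open>f\<close> folds at a value strictly between \<open>0\<close> and \<open>1\<close>, or breaks off there
  at an end of the interval. Ends of the interval are local extrema too, so a single condition
  on local extrema excludes both.\<close>
lemma locally_liftable:
  assumes pl: "linear_pieces f m c g" "\<And>i. i < m \<Longrightarrow> \<bar>g i\<bar> \<ge> \<kappa>" "\<kappa> > 1"
    and f: "f ` {0..1} \<subseteq> {0..1}"
    and x: "x \<in> {0..1}" "local_extremum f x \<Longrightarrow> f x \<in> {0, 1}"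
  shows "\<exists>r>0. \<forall>u\<in>{0..1}. \<bar>u - x\<bar> < r \<longrightarrow> (\<forall>y\<in>{0..1}. \<bar>y - f u\<bar> < r \<longrightarrow> liftable f \<kappa> u y)"
proof -
  have R: "\<exists>\<rho> a. \<bar>a\<bar> \<ge> \<kappa> \<and> affine_germ f x 1 \<rho> a" if "x \<noteq> 1"
    using affine_germ_right[OF pl(1), of x] pl(2) that x(1) by (metis atLeastAtMost_iff order_le_less)
  have L: "\<exists>\<rho> a. \<bar>a\<bar> \<ge> \<kappa> \<and> affine_germ f x (-1) \<rho> a" if "x \<noteq> 0"
    using affine_germ_left[OF pl(1), of x] pl(2) that x(1)
    by (metis abs_minus_cancel atLeastAtMost_iff order_le_less)
  consider "x = 0" | "x = 1" | "0 < x" "x < 1"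
    using x(1) by fastforce
  then show ?thesis
  proof cases
    case 1
    then obtain \<rho> a where a: "\<bar>a\<bar> \<ge> \<kappa>" and germ: "affine_germ f x 1 \<rho> a"
      using R by auto
    have "f x \<in> {0, 1}"
      using x(2) local_extremum_0 germ 1 by blast
    note lift = liftable_at_extreme_value[OF germ _ a pl(3) f this]
    have "\<rho> > 0"
      using germ by (simp add: affine_germ_def)
    moreover have "liftable f \<kappa> u y"
      if "u \<in> {0..1}" "\<bar>u - x\<bar> < \<rho> / 2" "y \<in> {0..1}" "\<bar>y - f u\<bar> < \<rho> / 2" for u y
      using lift[of u y] that 1 by simp
    ultimately show ?thesis
      by (intro exI[of _ "\<rho> / 2"]) auto
  next
    case 2
    then obtain \<rho> a where a: "\<bar>a\<bar> \<ge> \<kappa>" and germ: "affine_germ f x (-1) \<rho> a"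
      using L by auto
    have "f x \<in> {0, 1}"
      using x(2) local_extremum_1 germ 2 by blast
    note lift = liftable_at_extreme_value[OF germ _ a pl(3) f this]
    have "\<rho> > 0"
      using germ by (simp add: affine_germ_def)
    moreover have "liftable f \<kappa> u y"
      if "u \<in> {0..1}" "\<bar>u - x\<bar> < \<rho> / 2" "y \<in> {0..1}" "\<bar>y - f u\<bar> < \<rho> / 2" for u y
      using lift[of "1 - u" y] that 2 by simp
    ultimately show ?thesis
      by (intro exI[of _ "\<rho> / 2"]) auto
  next
    case 3
    then obtain \<rho> a where a: "\<bar>a\<bar> \<ge> \<kappa>" and right: "affine_germ f x 1 \<rho> a"
      using R by auto
    obtain \<rho>' b where b: "\<bar>b\<bar> \<ge> \<kappa>" and left: "affine_germ f x (-1) \<rho>' b"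
      using L 3 by auto
    define r where "r = min (\<rho> / 2) (\<rho>' / 2)"
    have pos: "\<rho> > 0" "\<rho>' > 0"
      using right left by (auto simp: affine_germ_def)
    have "liftable f \<kappa> u y" if u: "u \<in> {0..1}" "\<bar>u - x\<bar> < r" and y: "y \<in> {0..1}" "\<bar>y - f u\<bar> < r" for u y
    proof (cases "local_extremum f x")
      case True
      note ext = x(2)[OF True]
      show ?thesis
      proof (cases "u \<ge> x")
        case True
        then show ?thesis
          using liftable_at_extreme_value[OF right _ a pl(3) f ext, of "u - x" y] u y by (simp add: r_def)
      next
        case False
        then show ?thesis
          using liftable_at_extreme_value[OF left _ b pl(3) f ext, of "x - u" y] u y by (simp add: r_def)
      qed
    next
      case False
      then have ab: "a * b < 0"
        using local_extremum_interior[OF x(1) right left] by (meson not_le)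
      show ?thesis
      proof (cases "u \<ge> x")
        case True
        show ?thesis
        proof (cases "(y - f x) / a \<ge> 0")
          case same: True
          then show ?thesis
            using liftable_same_side[OF right _ a pl(3), of "u - x" y] u y True by (simp add: r_def)
        next
          case False
          then show ?thesis
            using liftable_other_side[OF right left _ a b pl(3) ab, of "u - x" y] u y True pos by (simp add: r_def)
        qed
      next
        case left_of: False
        show ?thesis
        proof (cases "(y - f x) / b \<ge> 0")
          case True
          then show ?thesis
            using liftable_same_side[OF left _ b pl(3), of "x - u" y] u y left_of by (simp add: r_def)
        next
          case False
          then show ?thesis
            using liftable_other_side[OF left _ _ b a pl(3), of \<rho> "x - u" y] right ab u y left_of pos
            by (simp add: r_def mult.commute)
        qed
      qed
    qed
    then show ?thesis
      using pos by (intro exI[of _ r]) (auto simp: r_def)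
  qed
qed

text \<open>The local radius \<open>r\<close> works for all points near \<open>x\<close>, so finitely many radii suffice.\<close>
lemma uniformly_liftable:
  assumes pl: "linear_pieces f m c g" "\<And>i. i < m \<Longrightarrow> \<bar>g i\<bar> \<ge> \<kappa>" "\<kappa> > 1"
    and f: "f ` {0..1} \<subseteq> {0..1}"
    and Y: "compact Y" "Y \<subseteq> {0..1}" "\<And>x. x \<in> Y \<Longrightarrow> local_extremum f x \<Longrightarrow> f x \<in> {0, 1}"
  shows "\<exists>\<delta>>0. \<forall>x\<in>Y. \<forall>y\<in>{0..1}. \<bar>y - f x\<bar> < \<delta> \<longrightarrow> liftable f \<kappa> x y"
proof -
  have "\<forall>x\<in>Y. \<exists>r>0. \<forall>u\<in>{0..1}. \<bar>u - x\<bar> < r \<longrightarrow> (\<forall>y\<in>{0..1}. \<bar>y - f u\<bar> < r \<longrightarrow> liftable f \<kappa> u y)"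
    using locally_liftable[OF pl f] Y by blast
  then obtain r where r: "\<And>x. x \<in> Y \<Longrightarrow> r x > 0"
    "\<And>x u y. x \<in> Y \<Longrightarrow> u \<in> {0..1} \<Longrightarrow> \<bar>u - x\<bar> < r x \<Longrightarrow> y \<in> {0..1} \<Longrightarrow> \<bar>y - f u\<bar> < r x \<Longrightarrow> liftable f \<kappa> u y"
    by metis
  have "Y \<subseteq> (\<Union>x\<in>Y. ball x (r x))"
    using r(1) by auto
  then obtain C where C: "C \<subseteq> Y" "finite C" "Y \<subseteq> (\<Union>x\<in>C. ball x (r x))"
    using compactE_image[OF Y(1), of Y "\<lambda>x. ball x (r x)"] by auto
  define \<delta> where "\<delta> = Min (insert 1 (r ` C))"
  have "\<delta> > 0"
    using C r(1) by (auto simp: \<delta>_def)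
  moreover have "liftable f \<kappa> x y" if x: "x \<in> Y" and y: "y \<in> {0..1}" "\<bar>y - f x\<bar> < \<delta>" for x y
  proof -
    obtain w where w: "w \<in> C" "\<bar>x - w\<bar> < r w"
      using subsetD[OF C(3) x] by (auto simp: dist_real_def abs_minus_commute)
    have "\<delta> \<le> r w"
      using C(2) w(1) by (simp add: \<delta>_def)
    then show ?thesis
      using r(2)[of w x y] w x y subsetD[OF C(1)] subsetD[OF Y(2)] by auto
  qed
  ultimately show ?thesis
    by blast
qed

lemma compact_dynamics_interval:
  assumes "interval_map f"
  shows "compact_dynamics unit_interval f"
proof
  have top: "mtopology_of unit_interval = top_of_set {0..1::real}"
    by (simp add: mtopology_of_submetric)
  show "compact_space (mtopology_of unit_interval)"
    unfolding top by (simp add: compact_space_subtopology)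
  show "continuous_map (mtopology_of unit_interval) (mtopology_of unit_interval) f"
    unfolding top using assms by (auto simp: interval_map_def continuous_map_in_subtopology)
qed

lemma interval_limit_set_characterization:
  assumes f: "expanding_piecewise_linear f"
    and Y: "closedin (mtopology_of unit_interval) Y" "Y \<noteq> {}"
    and extrema: "\<And>x. f ` Y = Y \<Longrightarrow> x \<in> Y \<Longrightarrow> local_extremum f x \<Longrightarrow> f x \<in> {0, 1}"
  shows "((\<forall>p. Y = {p} \<longrightarrow> f p = p) \<longrightarrow>
      (weakly_incompressible unit_interval f Y \<longleftrightarrow> internally_chain_transitive unit_interval f Y)) \<and>
    (internally_chain_transitive unit_interval f Y \<longleftrightarrow>
      (\<exists>x\<in>mspace unit_interval. Y = omega_limit unit_interval f x))"
proof -
  have im: "interval_map f"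
    using f by (simp add: expanding_piecewise_linear_def)
  interpret compact_dynamics unit_interval f
    using compact_dynamics_interval[OF im] .
  have Y01: "Y \<subseteq> {0..1}"
    using closedin_subset[OF Y(1)] by simp
  have "compactin (top_of_set {0..1}) Y"
    using closedin_compact_space[OF compact Y(1)] by (simp add: mtopology_of_submetric)
  then have "compact Y"
    by (simp add: compactin_subtopology)
  obtain m c g where pl: "linear_pieces f m c g" "\<And>i. i < m \<Longrightarrow> \<bar>g i\<bar> > 1"
    using f unfolding expanding_piecewise_linear_def by blast
  define \<kappa> where "\<kappa> = Min (insert 2 ((\<lambda>i. \<bar>g i\<bar>) ` {..<m}))"
  have \<kappa>: "\<kappa> > 1" "\<And>i. i < m \<Longrightarrow> \<kappa> \<le> \<bar>g i\<bar>"
    using pl(2) by (auto simp: \<kappa>_def intro!: Min_le)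
  show ?thesis
  proof (rule limit_set_characterization[OF Y])
    assume "internally_chain_transitive unit_interval f Y"
    then have "f ` Y = Y"
      using chain_transitive_imp_image_eq Y(1) by blast
    then obtain \<delta> where d: "\<delta> > 0"
      "\<And>x y. x \<in> Y \<Longrightarrow> y \<in> {0..1} \<Longrightarrow> \<bar>y - f x\<bar> < \<delta> \<Longrightarrow> liftable f \<kappa> x y"
      using uniformly_liftable[OF pl(1) \<kappa>(2,1) _ \<open>compact Y\<close> Y01 extrema] im
      unfolding interval_map_def by blast
    show "asymptotic_shadowing Y"
    proof (rule expanding_lifts_imp_asymptotic_shadowing[OF _ \<kappa>(1) d(1)])
      fix x y assume "x \<in> Y" "y \<in> mspace unit_interval" "mdist unit_interval (f x) y < \<delta>"
      then have "liftable f \<kappa> x y"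
        by (intro d(2)) (auto simp: dist_real_def abs_minus_commute)
      then show "\<exists>x'\<in>mspace unit_interval. f x' = y \<and>
          \<kappa> * mdist unit_interval x x' \<le> mdist unit_interval (f x) y"
        by (auto simp: liftable_def dist_real_def abs_minus_commute)
    qed (use Y01 in auto)
  qed
qed

lemma extreme_value_imp_critical:
  assumes f: "f ` {0..1} \<subseteq> {0..1}" and p: "p \<in> {0<..<1}" "f p \<in> {0, 1}"
  shows "critical_point f p"
proof -
  have "local_extremum f p"
    by (rule local_extremumI[of _ 1]) (use f p in \<open>auto simp: image_subset_iff\<close>)
  then show ?thesis
    using p by (simp add: critical_point_def)
qed

text \<open>This reduces maps whose critical values avoid \<open>Y\<close> to the condition of \<open>locally_liftable\<close>. Such
  a \<open>Y\<close> contains no critical point, so a local extremum \<open>x \<in> Y\<close> is an end of the interval. As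
  \<open>f ` Y = Y\<close>, it has a preimage in \<open>Y\<close>, which is an end as well, since an interior point with an
  extreme value is critical. So with \<open>f p = x\<close> and \<open>f q = p\<close>, two of the ends \<open>x\<close>, \<open>p\<close> and \<open>q\<close>
  coincide; in each case \<open>x\<close> is \<open>p\<close> or \<open>q\<close>, whose images are ends.\<close>
lemma extreme_value_of_invariant_set:
  assumes f: "f ` {0..1} \<subseteq> {0..1}" and Y: "Y \<subseteq> {0..1}" "f ` Y = Y"
    and crit: "\<And>c. critical_point f c \<Longrightarrow> f c \<notin> Y"
    and x: "x \<in> Y" "local_extremum f x"
  shows "f x \<in> {0, 1}"
proof -
  have end_point: "p \<in> {0, 1}" if "p \<in> Y" "f p \<in> {0, 1}" for p
  proof (rule ccontr)
    assume "p \<notin> {0, 1}"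
    then have "p \<in> {0<..<1}"
      using that(1) Y(1) by fastforce
    then show False
      using extreme_value_imp_critical[OF f _ that(2)] crit that(1) Y(2) by blast
  qed
  have "\<not> critical_point f x"
    using crit x(1) Y(2) by blast
  then have x01: "x \<in> {0, 1}"
    using x Y(1) unfolding critical_point_def by fastforce
  obtain p where p: "p \<in> Y" "f p = x"
    using x(1) Y(2) by (metis imageE)
  obtain q where q: "q \<in> Y" "f q = p"
    using p(1) Y(2) by (metis imageE)
  have p01: "p \<in> {0, 1}"
    using end_point p x01 by blast
  then have "q \<in> {0, 1}"
    using end_point q by blast
  then show ?thesis
    using p01 x01 p(2) q(2) by auto
qed

lemma uniformly_imp_expanding: "uniformly_piecewise_linear f \<Longrightarrow> expanding_piecewise_linear f"
  unfolding uniformly_piecewise_linear_def expanding_piecewise_linear_def by metis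

section \<open>Shifts of finite type\<close>

lemma funpow_shift: "(shift ^^ n) x = (\<lambda>i. x (i + of_nat n))"
  by (induction n) (auto simp: shift_def ac_simps)

lemma shift_in_shift_space: "x \<in> shift_space A F \<Longrightarrow> shift x \<in> shift_space A F"
proof -
  have "contains_word x w" if w: "contains_word (shift x) w" for w
  proof -
    obtain i where "\<And>j. j < length w \<Longrightarrow> x (i + of_nat j + 1) = w ! j"
      using w unfolding contains_word_def shift_def by blast
    then show ?thesis
      unfolding contains_word_def by (intro exI[of _ "i + 1"]) (simp add: ac_simps)
  qed
  then show "x \<in> shift_space A F \<Longrightarrow> shift x \<in> shift_space A F"
    unfolding shift_space_def by (auto simp: shift_def)
qed

abbreviation full_shift :: "'a set \<Rightarrow> ('i \<Rightarrow> 'a) topology" where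
  "full_shift A \<equiv> product_topology (\<lambda>_. discrete_topology A) UNIV"

lemma topspace_full_shift: "x \<in> topspace (full_shift A) \<longleftrightarrow> range x \<subseteq> A"
  by (auto simp: PiE_iff)

lemma openin_cylinder:
  assumes "finite K"
  shows "openin (full_shift A) {y. range y \<subseteq> A \<and> (\<forall>k\<in>K. y k = x k)}"
proof -
  define U where "U k = (if k \<in> K then A \<inter> {x k} else A)" for k
  have U_iff: "a \<in> U k \<longleftrightarrow> a \<in> A \<and> (k \<in> K \<longrightarrow> a = x k)" for a k
    by (simp add: U_def)
  have "openin (full_shift A) (PiE UNIV U)"
  proof (rule product_topology_basis)
    show "finite {i. U i \<noteq> topspace (discrete_topology A)}"
      by (rule finite_subset[OF _ assms]) (auto simp: U_def)
  qed (auto simp: U_def)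
  moreover have "PiE UNIV U = {y. range y \<subseteq> A \<and> (\<forall>k\<in>K. y k = x k)}"
    by (simp add: set_eq_iff PiE_iff U_iff image_subset_iff) blast
  ultimately show ?thesis
    by simp
qed

lemma open_contains_cylinder:
  assumes "openin (full_shift A) U" "x \<in> U"
  shows "\<exists>K. finite K \<and> {y. range y \<subseteq> A \<and> (\<forall>k\<in>K. y k = x k)} \<subseteq> U"
proof -
  obtain V where V: "x \<in> PiE UNIV V" "\<And>i. openin (discrete_topology A) (V i)"
    "finite {i. V i \<noteq> topspace (discrete_topology A)}" "PiE UNIV V \<subseteq> U"
    using product_topology_open_contains_basis[OF assms] by blast
  have "y i \<in> V i" if y: "range y \<subseteq> A" "\<forall>k\<in>{i. V i \<noteq> A}. y k = x k" for y i
  proof (cases "V i = A")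
    case True
    then show ?thesis
      using y(1) by auto
  next
    case False
    then show ?thesis
      using y(2) V(1) by (auto simp: PiE_iff)
  qed
  then have "{y. range y \<subseteq> A \<and> (\<forall>k\<in>{i. V i \<noteq> A}. y k = x k)} \<subseteq> U"
    using V(4) by (auto simp: PiE_iff subset_iff)
  then show ?thesis
    using V(3) by (intro exI[of _ "{i. V i \<noteq> A}"]) auto
qed

lemma closedin_shift_space: "closedin (full_shift A) (shift_space A F)"
  unfolding closedin_def
proof
  show "shift_space A F \<subseteq> topspace (full_shift A)"
    using topspace_full_shift by (force simp: shift_space_def)
  show "openin (full_shift A) (topspace (full_shift A) - shift_space A F)"
  proof (subst openin_subopen, intro ballI)
    fix x assume "x \<in> topspace (full_shift A) - shift_space A F"
    then have "range x \<subseteq> A" "x \<notin> shift_space A F"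
      by (auto simp: PiE_iff)
    then obtain w i where w: "w \<in> F" "\<And>j. j < length w \<Longrightarrow> x (i + of_nat j) = w ! j"
      by (auto simp: shift_space_def contains_word_def)
    define C where "C = {y. range y \<subseteq> A \<and> (\<forall>k\<in>(\<lambda>j. i + of_nat j) ` {..<length w}. y k = x k)}"
    have "openin (full_shift A) C"
      unfolding C_def by (rule openin_cylinder) simp
    moreover have "x \<in> C"
      using \<open>range x \<subseteq> A\<close> by (simp add: C_def)
    moreover have "y \<notin> shift_space A F" if "y \<in> C" for y
    proof -
      have "contains_word y w"
        using that w(2) unfolding C_def contains_word_def by auto
      then show ?thesis
        using w(1) by (auto simp: shift_space_def)
    qed
    moreover have "y \<in> topspace (full_shift A)" if "y \<in> C" for y
      using that unfolding topspace_full_shift C_def by simp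
    ultimately show "\<exists>T. openin (full_shift A) T \<and> x \<in> T \<and> T \<subseteq> topspace (full_shift A) - shift_space A F"
      by blast
  qed
qed

lemma mspace_shift_space: "finite_type_shift_space X A F \<Longrightarrow> mspace X = shift_space A F"
proof -
  assume "finite_type_shift_space X A F"
  then have "mspace X = topspace (full_shift A) \<inter> shift_space A F"
    unfolding finite_type_shift_space_def shift_topology_def
    by (metis topspace_mtopology_of topspace_subtopology)
  then show ?thesis
    using closedin_subset[OF closedin_shift_space] by blast
qed

lemma compact_dynamics_shift:
  assumes "finite_type_shift_space X A F"
  shows "compact_dynamics X shift"
proof
  have top: "mtopology_of X = subtopology (full_shift A) (shift_space A F)" and fin: "finite A"
    using assms by (auto simp: finite_type_shift_space_def shift_topology_def)
  have "compact_space (full_shift A)"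
    using fin by (simp add: compact_space_product_topology compact_space_discrete_topology)
  then show "compact_space (mtopology_of X)"
    unfolding top using closedin_compact_space[OF _ closedin_shift_space] compact_space_subtopology by blast
  have "continuous_map (subtopology (full_shift A) (shift_space A F)) (discrete_topology A) (\<lambda>x. shift x k)" for k
    unfolding shift_def
    by (intro continuous_map_from_subtopology continuous_map_product_projection) simp
  then show "continuous_map (mtopology_of X) (mtopology_of X) shift"
    unfolding top using shift_in_shift_space
    by (auto simp: continuous_map_in_subtopology continuous_map_componentwise_UNIV)
qed

text \<open>The cylinders on the coordinates \<open>K\<close> form an open cover; \<open>\<delta>\<close> is a Lebesgue number of it.\<close>
lemma close_imp_agree:
  assumes X: "finite_type_shift_space X A F" and K: "finite K"
  shows "\<exists>\<delta>>0. \<forall>x\<in>mspace X. \<forall>y\<in>mspace X. mdist X x y < \<delta> \<longrightarrow> (\<forall>k\<in>K. x k = y k)"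
proof -
  interpret compact_dynamics X shift
    using compact_dynamics_shift[OF X] .
  have top: "mtopology_of X = subtopology (full_shift A) (shift_space A F)"
    using X by (auto simp: finite_type_shift_space_def shift_topology_def)
  define C where "C x = shift_space A F \<inter> {y. range y \<subseteq> A \<and> (\<forall>k\<in>K. y k = x k)}" for x
  have "openin ms.mtopology U" if "U \<in> C ` mspace X" for U
    using that openin_subtopology_Int2[OF openin_cylinder[OF K]]
    unfolding C_def mtopology_eq[symmetric] top by blast
  moreover have "mspace X \<subseteq> \<Union> (C ` mspace X)"
    unfolding C_def mspace_shift_space[OF X] by (auto simp: shift_space_def)
  moreover have "compactin ms.mtopology (mspace X)"
    using compact unfolding mtopology_eq compact_space_def by simp
  ultimately obtain \<delta> where d: "\<delta> > 0" "\<forall>x\<in>mspace X. \<exists>U\<in>C ` mspace X. ms.mball x \<delta> \<subseteq> U"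
    using ms.lebesgue_number by metis
  have "x k = y k" if xy: "x \<in> mspace X" "y \<in> mspace X" "mdist X x y < \<delta>" and "k \<in> K" for x y k
  proof -
    obtain u where "ms.mball x \<delta> \<subseteq> C u"
      using d(2) xy(1) by blast
    then have "x \<in> C u" "y \<in> C u"
      using xy d(1) by auto
    then show ?thesis
      using \<open>k \<in> K\<close> by (simp add: C_def)
  qed
  then show ?thesis
    using d(1) by blast
qed

text \<open>Every ball of radius \<open>\<epsilon> / 2\<close> contains a cylinder around its centre, and finitely many of these
  cylinders cover the space; \<open>K\<close> collects their coordinates.\<close>
lemma agree_imp_close:
  assumes X: "finite_type_shift_space X A F" and "\<epsilon> > 0"
  shows "\<exists>K. finite K \<and> (\<forall>x\<in>mspace X. \<forall>y\<in>mspace X. (\<forall>k\<in>K. x k = y k) \<longrightarrow> mdist X x y < \<epsilon>)"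
proof -
  interpret compact_dynamics X shift
    using compact_dynamics_shift[OF X] .
  have top: "mtopology_of X = subtopology (full_shift A) (shift_space A F)"
    using X by (auto simp: finite_type_shift_space_def shift_topology_def)
  note ms = mspace_shift_space[OF X]
  have inA: "range y \<subseteq> A" if "y \<in> mspace X" for y
    using that unfolding ms by (simp add: shift_space_def)
  have "\<exists>K. finite K \<and> (\<forall>y\<in>mspace X. (\<forall>k\<in>K. y k = x k) \<longrightarrow> mdist X x y < \<epsilon> / 2)"
    if x: "x \<in> mspace X" for x
  proof -
    have "openin (mtopology_of X) (ms.mball x (\<epsilon> / 2))"
      unfolding mtopology_eq by simp
    then obtain U where U: "openin (full_shift A) U" "ms.mball x (\<epsilon> / 2) = U \<inter> shift_space A F"
      unfolding top openin_subtopology by blast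
    have "x \<in> ms.mball x (\<epsilon> / 2)"
      using x assms(2) by simp
    then have "x \<in> U"
      using U(2) by blast
    then obtain K where K: "finite K" "{y. range y \<subseteq> A \<and> (\<forall>k\<in>K. y k = x k)} \<subseteq> U"
      using open_contains_cylinder[OF U(1)] by blast
    have "y \<in> ms.mball x (\<epsilon> / 2)" if "y \<in> mspace X" "\<forall>k\<in>K. y k = x k" for y
      using U(2) K(2) inA[OF that(1)] that ms by blast
    then show ?thesis
      using K(1) by auto
  qed
  then obtain K where K: "\<And>x. x \<in> mspace X \<Longrightarrow> finite (K x)"
    "\<And>x y. x \<in> mspace X \<Longrightarrow> y \<in> mspace X \<Longrightarrow> \<forall>k\<in>K x. y k = x k \<Longrightarrow> mdist X x y < \<epsilon> / 2"
    by metis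
  define C where "C x = shift_space A F \<inter> {y. range y \<subseteq> A \<and> (\<forall>k\<in>K x. y k = x k)}" for x
  have "openin (mtopology_of X) U" if "U \<in> C ` mspace X" for U
    using that openin_subtopology_Int2[OF openin_cylinder[OF K(1)]]
    unfolding C_def top by blast
  moreover have "mspace X \<subseteq> \<Union> (C ` mspace X)"
    unfolding C_def ms by (auto simp: shift_space_def)
  ultimately obtain V where V: "finite V" "V \<subseteq> C ` mspace X" "mspace X \<subseteq> \<Union> V"
    using compact unfolding compact_space_alt topspace_mtopology_of by meson
  then obtain D where D: "D \<subseteq> mspace X" "finite D" "V = C ` D"
    using finite_subset_image by metis
  have "mdist X x y < \<epsilon>" if xy: "x \<in> mspace X" "y \<in> mspace X" "\<forall>k\<in>\<Union>(K ` D). x k = y k" for x y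
  proof -
    obtain u where u: "u \<in> D" "x \<in> C u"
      using V(3) D(3) xy(1) by blast
    then have x: "\<forall>k\<in>K u. x k = u k"
      by (simp add: C_def)
    then have y: "\<forall>k\<in>K u. y k = u k"
      using xy(3) u(1) by (metis UN_I)
    have "u \<in> mspace X"
      using u D by blast
    then have "mdist X u x < \<epsilon> / 2" "mdist X u y < \<epsilon> / 2" "mdist X x y \<le> mdist X u x + mdist X u y"
      using K(2) x y xy ms.triangle''[of x u y] by auto
    then show ?thesis
      by simp
  qed
  moreover have "finite (\<Union>(K ` D))"
    using D K(1) by auto
  ultimately show ?thesis
    by blast
qed

text \<open>While the errors vanish on the coordinates \<open>k, ..., k + p - 1\<close>, the symbol at \<open>k + p\<close> travels
  to \<open>k\<close> in \<open>p\<close> steps.\<close>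
lemma shift_slide:
  fixes z :: "nat \<Rightarrow> 'i::semiring_1 \<Rightarrow> 'a"
  assumes "\<And>m q. m \<ge> N \<Longrightarrow> q < p \<Longrightarrow> shift (z m) (k + of_nat q) = z (Suc m) (k + of_nat q)" and "m \<ge> N"
  shows "z m (k + of_nat p) = z (m + p) k"
  using assms
proof (induction p arbitrary: m)
  case (Suc p)
  have "z m (k + of_nat (Suc p)) = shift (z m) (k + of_nat p)"
    by (simp add: shift_def ac_simps)
  also have "\<dots> = z (Suc m) (k + of_nat p)"
    using Suc.prems by simp
  also have "\<dots> = z (Suc m + p) k"
    using Suc.prems by (intro Suc.IH) auto
  finally show ?case
    by simp
qed simp

text \<open>The shadowing point: the zeroth symbols of the pseudo-orbit, preceded, in the two-sided case, by
  the past of \<open>z 0\<close>.\<close>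
definition glue :: "(nat \<Rightarrow> 'i::semiring_1 \<Rightarrow> 'a) \<Rightarrow> 'i \<Rightarrow> 'a" where
  "glue z i = (if i \<in> range of_nat then z (inv of_nat i) 0 else z 0 i)"

lemma glue_of_nat: "glue z (of_nat n :: 'i::linordered_semidom) = z n 0"
  by (simp add: glue_def inv_f_f inj_of_nat)

text \<open>A window that starts at \<open>of_nat n\<close> is read off \<open>z n\<close>, any other window off \<open>z 0\<close> at its own
  place. The latter also holds when the window runs across \<open>0\<close>: the symbols \<open>z q 0\<close> in it have
  \<open>q \<le> L\<close> and slide without error from \<open>z 0\<close>. The assumption \<open>idx\<close> says that every index is a natural number or the negative of
  one; it holds for \<open>nat\<close> and for \<open>int\<close>, so that one-sided and two-sided shifts are treated
  together.\<close>
lemma glue_window: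
  fixes z :: "nat \<Rightarrow> 'i::linordered_semidom \<Rightarrow> 'a"
  assumes idx: "\<And>i::'i. (\<exists>n. i = of_nat n) \<or> (\<exists>n. i + of_nat n = 0)"
    and agree: "\<And>n q. q \<le> L \<Longrightarrow> shift (z n) (of_nat q) = z (Suc n) (of_nat q)"
  shows "\<exists>n k. \<forall>j\<le>L. glue z (i + of_nat j) = z n (k + of_nat j)"
proof -
  have G: "z n (of_nat j) = z (n + j) 0" if "j \<le> L" for n j
    using shift_slide[of 0 j z 0 n] agree that by simp
  show ?thesis
  proof (cases "i \<in> range of_nat")
    case True
    then obtain n where "i = of_nat n"
      by blast
    then have "glue z (i + of_nat j) = z n (0 + of_nat j)" if "j \<le> L" for j
      using G[OF that] glue_of_nat[of z "n + j"] by simp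
    then show ?thesis
      by blast
  next
    case False
    then obtain p where p: "i + of_nat p = 0"
      using idx by blast
    have "glue z (i + of_nat j) = z 0 (i + of_nat j)" if "j \<le> L" for j
    proof (cases "i + of_nat j \<in> range of_nat")
      case True
      then obtain q where q: "i + of_nat j = of_nat q"
        by blast
      then have "of_nat (q + p) = (i + of_nat p) + (of_nat j :: 'i)"
        by (simp add: ac_simps flip: q)
      then have "q + p = j"
        unfolding p by (simp flip: of_nat_add)
      then show ?thesis
        using q G[of q 0] that glue_of_nat[of z q] by simp
    qed (simp add: glue_def)
    then show ?thesis
      by blast
  qed
qed

text \<open>Finite type enters here: forbidden words fit into windows that occur in points of the shift
  space.\<close>
lemma glue_in_shift_space:
  fixes z :: "nat \<Rightarrow> 'i::linordered_semidom \<Rightarrow> 'a"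
  assumes idx: "\<And>i::'i. (\<exists>n. i = of_nat n) \<or> (\<exists>n. i + of_nat n = 0)"
    and agree: "\<And>n q. q \<le> L \<Longrightarrow> shift (z n) (of_nat q) = z (Suc n) (of_nat q)"
    and L: "\<And>w. w \<in> F \<Longrightarrow> length w \<le> L" and z: "\<And>n. z n \<in> shift_space A F"
  shows "glue z \<in> shift_space A F"
proof -
  have "glue z i \<in> A" for i
    using z by (auto simp: shift_space_def glue_def)
  moreover have "\<not> contains_word (glue z) w" if w: "w \<in> F" for w
  proof
    assume "contains_word (glue z) w"
    then obtain i where i: "\<And>j. j < length w \<Longrightarrow> glue z (i + of_nat j) = w ! j"
      unfolding contains_word_def by blast
    obtain n k where "\<forall>j\<le>L. glue z (i + of_nat j) = z n (k + of_nat j)"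
      using glue_window[where z = z and L = L, OF idx agree] by blast
    then have "contains_word (z n) w"
      unfolding contains_word_def using i L[OF w] by (intro exI[of _ k]) (metis less_imp_le order.trans)
    then show False
      using z w by (auto simp: shift_space_def)
  qed
  ultimately show ?thesis
    by (auto simp: shift_space_def)
qed

text \<open>For large \<open>n\<close>, coordinate \<open>k\<close> of the \<open>n\<close>-th shift of the glued sequence is the zeroth symbol of
  \<open>z (n + k)\<close>. The errors on the finitely many coordinates between \<open>0\<close> and \<open>k\<close> have vanished by
  then, so it is also coordinate \<open>k\<close> of \<open>z n\<close>. So all coordinates agree eventually, which by
  compactness is convergence in any compatible metric.\<close>
lemma shift_asymptotic_shadowing:
  fixes X :: "('i::linordered_semidom \<Rightarrow> 'a) metric"
  assumes X: "finite_type_shift_space X A F" and sub: "Y \<subseteq> mspace X"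
    and idx: "\<And>i::'i. (\<exists>n. i = of_nat n) \<or> (\<exists>n. i + of_nat n = 0)"
  shows "compact_dynamics.asymptotic_shadowing X shift Y"
proof -
  interpret compact_dynamics X shift
    using compact_dynamics_shift[OF X] .
  have "finite F"
    using X by (simp add: finite_type_shift_space_def)
  define L where "L = Max (insert 0 (length ` F))"
  have L: "length w \<le> L" if "w \<in> F" for w
    using \<open>finite F\<close> that by (simp add: L_def)
  obtain \<delta> where d: "\<delta> > 0" "\<And>x y k. x \<in> mspace X \<Longrightarrow> y \<in> mspace X \<Longrightarrow> mdist X x y < \<delta> \<Longrightarrow>
      k \<in> of_nat ` {..L} \<Longrightarrow> x k = y k"
    using close_imp_agree[OF X, of "of_nat ` {..L}"] by (metis finite_atMost finite_imageI)
  show ?thesis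
    unfolding asymptotic_shadowing_def
  proof (intro exI[of _ \<delta>] conjI d(1) allI impI)
    fix z assume "(\<forall>n. z n \<in> Y \<and> mdist X (shift (z n)) (z (Suc n)) < \<delta>) \<and>
      (\<lambda>n. mdist X (shift (z n)) (z (Suc n))) \<longlonglongrightarrow> 0"
    then have z: "\<And>n. z n \<in> mspace X" "\<And>n. mdist X (shift (z n)) (z (Suc n)) < \<delta>"
      and lim: "(\<lambda>n. mdist X (shift (z n)) (z (Suc n))) \<longlonglongrightarrow> 0"
      using sub by auto
    have glue: "glue z \<in> mspace X"
      unfolding mspace_shift_space[OF X]
    proof (rule glue_in_shift_space[OF idx _ L])
      show "shift (z n) (of_nat q) = z (Suc n) (of_nat q)" if "q \<le> L" for n q
        using z that by (intro d(2)) auto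
      show "z n \<in> shift_space A F" for n
        using z(1) mspace_shift_space[OF X] by blast
    qed
    have ev: "\<forall>\<^sub>F m in sequentially. shift (z m) c = z (Suc m) c" for c
    proof -
      obtain \<eta> where e: "\<eta> > 0" "\<And>x y. x \<in> mspace X \<Longrightarrow> y \<in> mspace X \<Longrightarrow> mdist X x y < \<eta> \<Longrightarrow> x c = y c"
        using close_imp_agree[OF X, of "{c}"] by auto
      show ?thesis
        using order_tendstoD(2)[OF lim e(1)] by (rule eventually_mono) (use e(2) z(1) in auto)
    qed
    have slide_ev: "\<exists>N. \<forall>m\<ge>N. z m (k + of_nat p) = z (m + p) k" for k p
    proof -
      have "\<forall>\<^sub>F m in sequentially. \<forall>q\<in>{..<p}. shift (z m) (k + of_nat q) = z (Suc m) (k + of_nat q)"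
        using ev by (intro eventually_ball_finite) auto
      then obtain N where N: "\<And>m q. m \<ge> N \<Longrightarrow> q < p \<Longrightarrow> shift (z m) (k + of_nat q) = z (Suc m) (k + of_nat q)"
        by (auto simp: eventually_sequentially)
      show ?thesis
        using shift_slide[of N p z k, OF N] by blast
    qed
    have coord: "\<forall>\<^sub>F n in sequentially. (shift ^^ n) (glue z) k = z n k" for k
    proof (cases "k \<in> range of_nat")
      case True
      then obtain j where j: "k = of_nat j"
        by blast
      obtain N where N: "\<And>m. m \<ge> N \<Longrightarrow> z m (0 + of_nat j) = z (m + j) 0"
        using slide_ev[of 0 j] by blast
      have "(shift ^^ n) (glue z) k = z n k" if "n \<ge> N" for n
        using N[OF that] glue_of_nat[of z "j + n"] by (simp add: funpow_shift j add.commute)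
      then show ?thesis
        by (auto simp: eventually_sequentially)
    next
      case False
      then obtain p where p: "k + of_nat p = 0"
        using idx by blast
      obtain N where N: "\<And>m. m \<ge> N \<Longrightarrow> z m (k + of_nat p) = z (m + p) k"
        using slide_ev[of k p] by blast
      have "(shift ^^ n) (glue z) k = z n k" if "n \<ge> N + p" for n
      proof -
        define m where "m = n - p"
        have m: "m \<ge> N" "n = p + m"
          using that by (auto simp: m_def)
        have "k + of_nat n = of_nat m"
          unfolding m(2) of_nat_add add.assoc[symmetric] p by simp
        then show ?thesis
          using N[OF m(1)] glue_of_nat[of z m] by (simp add: funpow_shift p m(2) add.commute)
      qed
      then show ?thesis
        unfolding eventually_sequentially by blast
    qed
    have "(\<lambda>n. mdist X ((shift ^^ n) (glue z)) (z n)) \<longlonglongrightarrow> 0"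
    proof (rule order_tendstoI)
      fix \<epsilon> :: real assume "\<epsilon> > 0"
      then obtain K where K: "finite K"
        "\<And>x y. x \<in> mspace X \<Longrightarrow> y \<in> mspace X \<Longrightarrow> \<forall>k\<in>K. x k = y k \<Longrightarrow> mdist X x y < \<epsilon>"
        using agree_imp_close[OF X] by metis
      have "\<forall>\<^sub>F n in sequentially. \<forall>k\<in>K. (shift ^^ n) (glue z) k = z n k"
        using coord K(1) by (intro eventually_ball_finite) auto
      then show "\<forall>\<^sub>F n in sequentially. mdist X ((shift ^^ n) (glue z)) (z n) < \<epsilon>"
        by (rule eventually_mono) (use K(2) glue z(1) in auto)
    qed (auto intro!: always_eventually less_le_trans[OF _ mdist_nonneg])
    then show "\<exists>x\<in>mspace X. (\<lambda>n. mdist X ((shift ^^ n) x) (z n)) \<longlonglongrightarrow> 0"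
      using glue by blast
  qed
qed

lemma shift_limit_set_characterization:
  fixes X :: "('i::linordered_semidom \<Rightarrow> 'a) metric"
  assumes X: "finite_type_shift_space X A F" and Y: "closedin (mtopology_of X) Y" "Y \<noteq> {}"
    and idx: "\<And>i::'i. (\<exists>n. i = of_nat n) \<or> (\<exists>n. i + of_nat n = 0)"
  shows "((\<forall>p. Y = {p} \<longrightarrow> shift p = p) \<longrightarrow>
      (weakly_incompressible X shift Y \<longleftrightarrow> internally_chain_transitive X shift Y)) \<and>
    (internally_chain_transitive X shift Y \<longleftrightarrow> (\<exists>x\<in>mspace X. Y = omega_limit X shift x))"
proof -
  interpret compact_dynamics X shift
    using compact_dynamics_shift[OF X] .
  show ?thesis
    using limit_set_characterization[OF Y] shift_asymptotic_shadowing[OF X _ idx] closedin_subset[OF Y(1)] by auto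
qed

section \<open>Characterization of limit sets\<close>

theorem corollary1p2:
  shows
   "(\<forall>(f :: real \<Rightarrow> real) \<Lambda> Y.
       closedin (mtopology_of unit_interval) \<Lambda> \<and>
       ((uniformly_piecewise_linear f \<and> (\<forall>c. local_extremum f c \<longrightarrow> f c \<in> {0, 1})) \<or>
        (expanding_piecewise_linear f \<and> (\<forall>c. critical_point f c \<longrightarrow> f c \<notin> \<Lambda>))) \<and>
       closedin (mtopology_of unit_interval) Y \<and> Y \<noteq> {} \<and> Y \<subseteq> \<Lambda> \<longrightarrow>
       ((\<forall>p. Y = {p} \<longrightarrow> f p = p) \<longrightarrow>
          (weakly_incompressible unit_interval f Y \<longleftrightarrow>
           internally_chain_transitive unit_interval f Y)) \<and>
       (internally_chain_transitive unit_interval f Y \<longleftrightarrow>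
          (\<exists>x\<in>mspace unit_interval. Y = omega_limit unit_interval f x)))
    \<and>
    (\<forall>(X :: (nat \<Rightarrow> 'a) metric) A F \<Lambda> Y.
       finite_type_shift_space X A F \<and> closedin (mtopology_of X) \<Lambda> \<and>
       closedin (mtopology_of X) Y \<and> Y \<noteq> {} \<and> Y \<subseteq> \<Lambda> \<longrightarrow>
       ((\<forall>p. Y = {p} \<longrightarrow> shift p = p) \<longrightarrow>
          (weakly_incompressible X shift Y \<longleftrightarrow> internally_chain_transitive X shift Y)) \<and>
       (internally_chain_transitive X shift Y \<longleftrightarrow>
          (\<exists>x\<in>mspace X. Y = omega_limit X shift x)))
    \<and>
    (\<forall>(X :: (int \<Rightarrow> 'a) metric) A F \<Lambda> Y.
       finite_type_shift_space X A F \<and> closedin (mtopology_of X) \<Lambda> \<and>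
       closedin (mtopology_of X) Y \<and> Y \<noteq> {} \<and> Y \<subseteq> \<Lambda> \<longrightarrow>
       ((\<forall>p. Y = {p} \<longrightarrow> shift p = p) \<longrightarrow>
          (weakly_incompressible X shift Y \<longleftrightarrow> internally_chain_transitive X shift Y)) \<and>
       (internally_chain_transitive X shift Y \<longleftrightarrow>
          (\<exists>x\<in>mspace X. Y = omega_limit X shift x)))"
proof (intro conjI[of "\<forall>f \<Lambda> Y. P f \<Lambda> Y" for P] conjI[of "\<forall>X A F \<Lambda> Y. P X A F \<Lambda> Y" for P] allI impI; elim conjE)
  fix f :: "real \<Rightarrow> real" and \<Lambda> Y :: "real set"
  assume f: "(uniformly_piecewise_linear f \<and> (\<forall>c. local_extremum f c \<longrightarrow> f c \<in> {0, 1})) \<or>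
        (expanding_piecewise_linear f \<and> (\<forall>c. critical_point f c \<longrightarrow> f c \<notin> \<Lambda>))"
    and Y: "closedin (mtopology_of unit_interval) Y" "Y \<noteq> {}" "Y \<subseteq> \<Lambda>"
  have exp: "expanding_piecewise_linear f"
    using f uniformly_imp_expanding by blast
  then have into: "f ` {0..1} \<subseteq> {0..1}"
    by (simp add: expanding_piecewise_linear_def interval_map_def)
  have Y01: "Y \<subseteq> {0..1}"
    using closedin_subset[OF Y(1)] by simp
  show "((\<forall>p. Y = {p} \<longrightarrow> f p = p) \<longrightarrow>
          (weakly_incompressible unit_interval f Y \<longleftrightarrow>
           internally_chain_transitive unit_interval f Y)) \<and>
       (internally_chain_transitive unit_interval f Y \<longleftrightarrow>
          (\<exists>x\<in>mspace unit_interval. Y = omega_limit unit_interval f x))"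
  proof (rule interval_limit_set_characterization[OF exp Y(1,2)])
    fix x assume x: "f ` Y = Y" "x \<in> Y" "local_extremum f x"
    from f show "f x \<in> {0, 1}"
    proof
      assume "uniformly_piecewise_linear f \<and> (\<forall>c. local_extremum f c \<longrightarrow> f c \<in> {0, 1})"
      then show ?thesis
        using x(3) by blast
    next
      assume "expanding_piecewise_linear f \<and> (\<forall>c. critical_point f c \<longrightarrow> f c \<notin> \<Lambda>)"
      then have "f c \<notin> Y" if "critical_point f c" for c
        using that Y(3) by blast
      then show ?thesis
        by (rule extreme_value_of_invariant_set[OF into Y01 x(1) _ x(2,3)])
    qed
  qed
next
  fix X :: "(nat \<Rightarrow> 'a) metric" and A F Y
  assume "finite_type_shift_space X A F" "closedin (mtopology_of X) Y" "Y \<noteq> {}"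
  then show "((\<forall>p. Y = {p} \<longrightarrow> shift p = p) \<longrightarrow>
          (weakly_incompressible X shift Y \<longleftrightarrow> internally_chain_transitive X shift Y)) \<and>
       (internally_chain_transitive X shift Y \<longleftrightarrow>
          (\<exists>x\<in>mspace X. Y = omega_limit X shift x))"
    by (rule shift_limit_set_characterization) (metis of_nat_id)
next
  fix X :: "(int \<Rightarrow> 'a) metric" and A F Y
  assume "finite_type_shift_space X A F" "closedin (mtopology_of X) Y" "Y \<noteq> {}"
  moreover have "(\<exists>n. i = of_nat n) \<or> (\<exists>n. i + of_nat n = 0)" for i :: int
    by (cases i rule: int_cases2) auto
  ultimately show "((\<forall>p. Y = {p} \<longrightarrow> shift p = p) \<longrightarrow>
          (weakly_incompressible X shift Y \<longleftrightarrow> internally_chain_transitive X shift Y)) \<and>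
       (internally_chain_transitive X shift Y \<longleftrightarrow>
          (\<exists>x\<in>mspace X. Y = omega_limit X shift x))"
    by (rule shift_limit_set_characterization)
qed

end
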